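(* For a $1$-dimensional Bessel process $(X_t^\lambda)_{t\ge0}$ on $[0,\infty)$ with continuous paths, multiplicity $k\ge0$, drift $\lambda>0$, and start in $0$, $$\lim_{t\to\infty}\frac{X_t^\lambda}{t}=\lambda\quad\text{a.s.},$$ and $(X_t^\lambda-t\lambda)/\sqrt t$ tends in distribution to the normal distribution $N(0,1)$ for $t\to\infty$.
   Context: Spherical Bessel functions: $j_\alpha(z)=\Gamma(\alpha+1)\sum_{n=0}^\infty\frac{(-1)^n(z/2)^{2n}}{n!\,\Gamma(n+\alpha+1)}$ for $\alpha\ge-1/2$, $z\in\mathbb C$, and $J_k(x,y):=j_{k-1/2}(ixy)$. A $1$-dimensional Bessel process with multiplicity $k\ge0$ and drift $\lambda\ge0$ is a Feller diffusion on $[0,\infty)$ (reflecting at $0$) with transition kernels $$K_t^{\lambda,k}(x,A)=\frac{e^{-\lambda^2t/2}}{2^{k-1/2}\Gamma(k+1/2)\,t^{k+1/2}}\int_Ae^{-(x^2+y^2)/(2t)}\,\frac{J_k(\frac x{\sqrt t},\frac y{\sqrt t})\,J_k(y,\lambda)}{J_k(x,\lambda)}\,y^{2k}\,dy$$ for $t>0$, $x\ge0$ and Borel sets $A\subset[0,\infty)$. *)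

theory Defs
  imports "HOL-Probability.Probability"
begin

definition sph_bessel :: "real \<Rightarrow> complex \<Rightarrow> complex" where
  "sph_bessel \<alpha> z =
     Gamma (of_real \<alpha> + 1) *
       (\<Sum>n. (-1) ^ n * (z / 2) ^ (2 * n) / (fact n * Gamma (of_nat n + of_real \<alpha> + 1)))"

definition bessel_J :: "real \<Rightarrow> real \<Rightarrow> real \<Rightarrow> complex" where
  "bessel_J k x y = sph_bessel (k - 1 / 2) (\<i> * of_real (x * y))"

lemma sph_bessel_imaginary_real:
  assumes "\<alpha> > -1"
  shows "sph_bessel \<alpha> (\<i> * of_real x) =
    of_real (Gamma (\<alpha> + 1) * (\<Sum>n. (x / 2) ^ (2 * n) / (fact n * Gamma (real n + \<alpha> + 1))))"
proof -
  define f where "f = (\<lambda>n. (x / 2) ^ (2 * n) / (fact n * Gamma (real n + \<alpha> + 1)))"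
  have f_nonneg: "f n \<ge> 0" for n
    using assms by (simp add: f_def)
  obtain N :: nat where N: "real N \<ge> x\<^sup>2 + 2 - \<alpha>"
    using real_arch_simple by blast
  have "summable f"
  proof (rule summable_ratio_test[of "1 / 2" N])
    fix n assume "n \<ge> N"
    hence n: "real n \<ge> x\<^sup>2 + 2 - \<alpha>"
      using N by simp
    have pos: "real n + \<alpha> + 1 > 0"
      using assms by simp
    define d where "d = (real n + 1) * (real n + \<alpha> + 1)"
    have "Gamma (real (Suc n) + \<alpha> + 1) = (real n + \<alpha> + 1) * Gamma (real n + \<alpha> + 1)"
      using Gamma_plus1[of "real n + \<alpha> + 1"] pos nonpos_Ints_nonpos[of "real n + \<alpha> + 1"]
      by (force simp: add_ac)
    hence eq: "f (Suc n) = (x\<^sup>2 / (4 * d)) * f n"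
      by (simp add: f_def d_def power2_eq_square field_simps)
    have "d > 0"
      using pos by (simp add: d_def)
    have "1 * x\<^sup>2 \<le> d"
      unfolding d_def using n pos by (intro mult_mono) auto
    hence "x\<^sup>2 / (4 * d) \<le> 1 / 2"
      using \<open>d > 0\<close> by (simp add: field_simps)
    hence "f (Suc n) \<le> 1 / 2 * f n"
      unfolding eq by (intro mult_right_mono f_nonneg)
    thus "norm (f (Suc n)) \<le> 1 / 2 * norm (f n)"
      using f_nonneg[of n] f_nonneg[of "Suc n"] by simp
  qed simp
  have summand: "(-1) ^ n * (\<i> * of_real x / 2) ^ (2 * n) /
      (fact n * Gamma (of_nat n + of_real \<alpha> + 1)) = complex_of_real (f n)" for n
  proof -
    have "(-1) ^ n * (\<i> * of_real x / 2) ^ (2 * n) = complex_of_real ((x / 2) ^ (2 * n))"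
    proof -
      have "(\<i> * complex_of_real x / 2) ^ 2 = - (complex_of_real ((x / 2)\<^sup>2))"
        by (simp add: power2_eq_square field_simps)
      thus ?thesis
        by (simp add: power_mult power_mult_distrib[symmetric] del: power_divide)
    qed
    moreover have "Gamma (of_nat n + of_real \<alpha> + 1) = complex_of_real (Gamma (real n + \<alpha> + 1))"
      using Gamma_complex_of_real[of "real n + \<alpha> + 1"] by simp
    ultimately show ?thesis
      by (simp add: f_def)
  qed
  have "Gamma (of_real \<alpha> + 1) = complex_of_real (Gamma (\<alpha> + 1))"
    using Gamma_complex_of_real[of "\<alpha> + 1"] by simp
  moreover have "(\<Sum>n. complex_of_real (f n)) = complex_of_real (suminf f)"
    using suminf_of_real[OF \<open>summable f\<close>] by metis
  ultimately have "sph_bessel \<alpha> (\<i> * of_real x) = complex_of_real (Gamma (\<alpha> + 1) * suminf f)"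
    unfolding sph_bessel_def summand by simp
  thus ?thesis
    by (simp only: f_def)
qed

text \<open>
  For \<open>k \<ge> 0\<close> and real \<open>x\<close>, \<open>y\<close> the complex number \<open>bessel_J k x y\<close> is real
  by \<open>sph_bessel_imaginary_real\<close>, so taking the real part below only changes the type.
  For \<open>k = 0\<close> the factor \<open>y powr (2 * k)\<close> differs from the mathematical convention
  at \<open>y = 0\<close> only, which is a null set.
\<close>

definition bessel_kernel :: "real \<Rightarrow> real \<Rightarrow> real \<Rightarrow> real \<Rightarrow> real set \<Rightarrow> real" where
  "bessel_kernel lam k t x A =
     exp (- (lam\<^sup>2 * t / 2)) / (2 powr (k - 1 / 2) * Gamma (k + 1 / 2) * t powr (k + 1 / 2)) *
     (LINT y:A|lborel.
        exp (- ((x\<^sup>2 + y\<^sup>2) / (2 * t))) *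
        Re (bessel_J k (x / sqrt t) (y / sqrt t) * bessel_J k y lam / bessel_J k x lam) *
        y powr (2 * k))"

definition natural_filtration :: "'a measure \<Rightarrow> (real \<Rightarrow> 'a \<Rightarrow> real) \<Rightarrow> real \<Rightarrow> 'a measure" where
  "natural_filtration M X s =
     sigma (space M) {X r -` B \<inter> space M | r B. 0 \<le> r \<and> r \<le> s \<and> B \<in> sets borel}"

text \<open>
  The Markov process on \<open>{0..}\<close> with transition kernels \<open>bessel_kernel lam k\<close>; only the
  values \<open>X t\<close> for \<open>t \<ge> 0\<close> are relevant. The Feller property and the reflecting behaviour
  at \<open>0\<close> are properties of these kernels, not additional assumptions on the process.
  The initial distribution and path continuity are left open.
\<close>

locale bessel_process = prob_space M
  for M :: "'a measure" and k lam :: real and X :: "real \<Rightarrow> 'a \<Rightarrow> real" +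
  assumes multiplicity_nonneg: "k \<ge> 0"
    and drift_nonneg: "lam \<ge> 0"
    and measurable_X: "\<And>t. t \<ge> 0 \<Longrightarrow> X t \<in> borel_measurable M"
    and nonneg_X: "\<And>t \<omega>. t \<ge> 0 \<Longrightarrow> \<omega> \<in> space M \<Longrightarrow> X t \<omega> \<ge> 0"
    and markov: "\<And>s t A. s \<ge> 0 \<Longrightarrow> t > 0 \<Longrightarrow> A \<in> sets borel \<Longrightarrow> A \<subseteq> {0..} \<Longrightarrow>
      AE \<omega> in M. real_cond_exp M (natural_filtration M X s) (\<lambda>\<omega>. indicator A (X (s + t) \<omega>)) \<omega>
        = bessel_kernel lam k t (X s \<omega>) A"

text \<open>\<open>weak_conv_m\<close> with an arbitrary filter in place of \<open>sequentially\<close>.\<close>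

definition weak_conv_m_filter :: "('i \<Rightarrow> real measure) \<Rightarrow> real measure \<Rightarrow> 'i filter \<Rightarrow> bool" where
  "weak_conv_m_filter \<mu> \<nu> F \<longleftrightarrow>
     (\<forall>x. isCont (cdf \<nu>) x \<longrightarrow> ((\<lambda>i. cdf (\<mu> i) x) \<longlongrightarrow> cdf \<nu> x) F)"

lemma weak_conv_m_filter_sequentially:
  "weak_conv_m_filter \<mu> \<nu> sequentially \<longleftrightarrow> weak_conv_m \<mu> \<nu>"
  by (simp add: weak_conv_m_filter_def weak_conv_m_def weak_conv_def)

end

theory Submission
  imports Defs
begin

text \<open>
  Write \<open>E(z) = j\<^bsub>k-1/2\<^esub>(i z)\<close>. The process with drift \<open>\<lambda>\<close> is the Doob transform of the driftless
  one by \<open>E(\<lambda> x)\<close>, and Weber's second exponential integral says that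
  \<open>exp(-(\<mu>\<^sup>2 - \<lambda>\<^sup>2) t / 2) E(\<mu> X\<^sub>t) / E(\<lambda> X\<^sub>t)\<close> is a positive martingale for every \<open>\<mu>\<close>. By the maximal
  inequality it is almost surely bounded in \<open>t\<close>. As \<open>E(z)\<close> grows like \<open>exp z\<close> up to subexponential
  factors, this bounds \<open>(\<mu> - \<lambda>) X\<^sub>t\<close> by \<open>(\<mu>\<^sup>2 - \<lambda>\<^sup>2) t / 2 + o(t)\<close>; taking \<open>\<mu>\<close> slightly above and
  slightly below \<open>\<lambda>\<close> gives the strong law.

  For the central limit theorem, the characteristic function of \<open>X\<^sub>t\<^sup>2 / (2 t)\<close> is computed explicitly.
  Centred at \<open>\<lambda>\<^sup>2 t / 2\<close> and divided by \<open>\<lambda> \<surd>t\<close>, this variable tends to \<open>N(0, 1)\<close> by Levy's continuity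
  theorem, and it differs from \<open>(X\<^sub>t - \<lambda> t) / \<surd>t\<close> only through the map \<open>x \<mapsto> x + x\<^sup>2 / (2 \<lambda> \<surd>t)\<close>.
\<close>

subsection \<open>Modified Bessel functions and Weber's integral\<close>

text \<open>The confluent hypergeometric limit function \<open>0F1(; a; w)\<close>: by \<open>bessel_J_eq_hyp01\<close> below,
  \<open>bessel_J k x y\<close> is its value at \<open>a = k + 1 / 2\<close>, \<open>w = (x y)\<^sup>2 / 4\<close>.\<close>

definition hyp01 :: "real \<Rightarrow> real \<Rightarrow> real" where
  "hyp01 a w = (\<Sum>n. w ^ n / (fact n * pochhammer a n))"

text \<open>Every factor of the product except possibly the first is at least 1, so only
  \<open>a\<close> itself can pull it below 1. This uniform lower bound lets the exponential series
  dominate the series of \<open>hyp01\<close>.\<close>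

lemma pochhammer_ge_min:
  assumes "(a::real) > 0"
  shows "pochhammer a n \<ge> min 1 a"
proof (induction n)
  case (Suc n)
  have "pochhammer a n * (a + real n) \<ge> min 1 a"
  proof (cases n)
    case (Suc m)
    have "min 1 a * 1 \<le> pochhammer a n * (a + real n)"
      using Suc Suc.IH assms by (intro mult_mono) auto
    thus ?thesis by simp
  qed auto
  thus ?case by (simp add: pochhammer_Suc)
qed auto

lemma summable_norm_hyp01:
  assumes "a > 0"
  shows "summable (\<lambda>n. norm (w ^ n / (fact n * pochhammer a n :: real)))"
proof (rule summable_comparison_test')
  show "summable (\<lambda>n. (1 / min 1 a) * (\<bar>w\<bar> ^ n / fact n))"
    using summable_exp[of "\<bar>w\<bar>"] by (intro summable_mult) (simp add: field_simps)
  fix n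
  have "min 1 a > 0" using assms by simp
  have "norm (w ^ n / (fact n * pochhammer a n)) = \<bar>w\<bar> ^ n / fact n / pochhammer a n"
    using pochhammer_pos[OF assms, of n] by (simp add: power_abs)
  also have "\<dots> \<le> \<bar>w\<bar> ^ n / fact n / min 1 a"
    using pochhammer_ge_min[OF assms, of n] \<open>min 1 a > 0\<close> by (intro divide_left_mono mult_pos_pos) auto
  finally show "norm (norm (w ^ n / (fact n * pochhammer a n))) \<le> (1 / min 1 a) * (\<bar>w\<bar> ^ n / fact n)"
    by (simp add: mult.commute)
qed

lemma summable_hyp01:
  assumes "a > 0"
  shows "summable (\<lambda>n. w ^ n / (fact n * pochhammer a n :: real))"
  using summable_norm_hyp01[OF assms] by (rule summable_norm_cancel)

lemma hyp01_0 [simp]: "hyp01 a 0 = 1"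
  unfolding hyp01_def by (subst suminf_finite[of "{0}"]) auto

lemma hyp01_ge_1:
  assumes "a > 0" "w \<ge> 0"
  shows "hyp01 a w \<ge> 1"
proof -
  have "(\<Sum>n<1. w ^ n / (fact n * pochhammer a n)) \<le> hyp01 a w"
    unfolding hyp01_def using assms
    by (intro sum_le_suminf summable_hyp01) (auto intro!: divide_nonneg_nonneg mult_nonneg_nonneg less_imp_le[OF pochhammer_pos])
  thus ?thesis by simp
qed

lemma isCont_hyp01:
  assumes "a > 0"
  shows "isCont (hyp01 a) w"
proof -
  have "isCont (\<lambda>w. \<Sum>n. inverse (fact n * pochhammer a n) * w ^ n) w"
    by (rule isCont_powser_converges_everywhere)
       (use summable_hyp01[OF assms] in \<open>simp add: field_simps\<close>)
  thus ?thesis unfolding hyp01_def [abs_def] by (simp add: field_simps)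
qed

lemma continuous_on_hyp01 [continuous_intros]:
  assumes "a > 0" "continuous_on S f"
  shows "continuous_on S (\<lambda>x. hyp01 a (f x))"
  using continuous_on_compose2[OF continuous_at_imp_continuous_on[of UNIV "hyp01 a"] assms(2)]
    isCont_hyp01[OF assms(1)] by auto

lemma borel_measurable_hyp01:
  assumes "a > 0" "f \<in> borel_measurable M"
  shows "(\<lambda>x. hyp01 a (f x)) \<in> borel_measurable M"
  using borel_measurable_continuous_onI[of "hyp01 a"] assms
    continuous_on_hyp01[OF assms(1) continuous_on_id] by (auto intro: measurable_compose)

text \<open>The quotient of \<open>Gamma (real n + (k + 1 / 2))\<close> and
  \<open>Gamma (k + 1 / 2)\<close> is a rising factorial. From here on everything is real, and
  positivity of the kernels can be read off from the series.\<close>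

lemma bessel_J_eq_hyp01:
  assumes "k \<ge> 0"
  shows "bessel_J k x y = of_real (hyp01 (k + 1 / 2) ((x * y)\<^sup>2 / 4))"
proof -
  have nz: "k + 1 / 2 \<notin> \<int>\<^sub>\<le>\<^sub>0" using assms nonpos_Ints_nonpos[of "k + 1 / 2"] by auto
  have G: "Gamma (k + 1 / 2) > 0" using assms by (intro Gamma_real_pos) auto
  have *: "(x * y / 2) ^ (2 * n) / (fact n * Gamma (real n + (k - 1 / 2) + 1)) =
      (1 / Gamma (k + 1/2)) * (((x * y)\<^sup>2 / 4) ^ n / (fact n * pochhammer (k + 1/2) n))" for n
    using pochhammer_Gamma[OF nz, of n] G
    by (simp add: power_mult power_divide add_ac)
  have "Gamma (k - 1 / 2 + 1) * (\<Sum>n. (x * y / 2) ^ (2 * n) / (fact n * Gamma (real n + (k - 1 / 2) + 1))) =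
      hyp01 (k + 1 / 2) ((x * y)\<^sup>2 / 4)"
    unfolding * suminf_mult[OF summable_hyp01[of "k + 1/2"], OF add_nonneg_pos[OF assms half_gt_zero[OF zero_less_one]]] hyp01_def
    using G by (simp add: add_ac)
  hence "sph_bessel (k - 1/2) (\<i> * of_real (x * y)) = of_real (hyp01 (k + 1 / 2) ((x * y)\<^sup>2 / 4))"
    using assms by (subst sph_bessel_imaginary_real) simp_all
  thus ?thesis by (simp add: bessel_J_def)
qed

section \<open>Exponential growth bounds\<close>

lemma cosh_sums_even: "(\<lambda>n. z ^ (2*n) / fact (2*n)) sums cosh (z :: real)"
proof -
  have "(\<lambda>n. if even n then z ^ n / fact n else 0) sums cosh z"
    using cosh_converges[of z] by (simp add: if_distrib divide_inverse mult_ac cong: if_cong)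
  thus ?thesis
    by (subst (asm) sums_mono_reindex[of "\<lambda>n. 2 * n", symmetric])
       (auto simp: strict_mono_def elim!: evenE)
qed

text \<open>Shows termwise that \<open>hyp01 (1/2) (z\<^sup>2 / 4)\<close> is \<open>cosh z\<close>,
  the reference function for both growth bounds.\<close>

lemma pochhammer_half: "4 ^ n * fact n * pochhammer (1/2::real) n = fact (2 * n)"
  using fact_double[of n, where ?'a = real] by (simp add: power_mult)

text \<open>Raising the parameter from 1/2 to \<open>a\<close> enlarges every denominator, so the
  series lies below that of \<open>cosh z\<close>.\<close>

lemma hyp01_le_exp:
  assumes "a \<ge> 1/2" "z \<ge> 0"
  shows "hyp01 a (z\<^sup>2 / 4) \<le> exp z"
proof -
  have [simp]: "pochhammer a n > 0" for n using assms by (intro pochhammer_pos) auto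
  have s: "summable (\<lambda>n. z ^ (2*n) / fact (2*n))" "cosh z = (\<Sum>n. z ^ (2*n) / fact (2*n))"
    using cosh_sums_even[of z] by (auto simp: sums_iff)
  have "hyp01 a (z\<^sup>2 / 4) \<le> cosh z" unfolding hyp01_def s(2)
  proof (rule suminf_le[OF _ summable_hyp01 s(1)])
    fix n
    have "pochhammer (1/2) n \<le> pochhammer a n"
      unfolding pochhammer_prod using assms by (intro prod_mono) auto
    hence "(z\<^sup>2) ^ n / (4 ^ n * fact n * pochhammer a n) \<le> (z\<^sup>2) ^ n / (4 ^ n * fact n * pochhammer (1/2) n)"
      by (intro divide_left_mono mult_left_mono mult_pos_pos) (auto simp: pochhammer_pos)
    thus "(z\<^sup>2 / 4) ^ n / (fact n * pochhammer a n) \<le> z ^ (2 * n) / fact (2 * n)"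
      unfolding pochhammer_half power_mult[of z 2 n] by (simp add: power_divide mult_ac)
  qed (use assms in auto)
  also have "cosh z \<le> exp z"
    using assms by (simp add: cosh_def)
  finally show ?thesis .
qed

text \<open>Compared with \<open>cosh z\<close>, the coefficients lose only a factor of polynomial
  growth. Replacing \<open>z\<close> by \<open>z / q\<close> gains the geometric factor
  \<open>q ^ (2 * n)\<close>, which outweighs this loss.\<close>

lemma hyp01_ge_exp:
  assumes "a > 0" "q > 1"
  obtains c where "c > 0" "\<And>z. z \<ge> 0 \<Longrightarrow> hyp01 a (z\<^sup>2 / 4) \<ge> c * exp (z / q)"
proof -
  have pos [simp]: "pochhammer a n > 0" "pochhammer (1/2::real) n > 0" for n
    using assms by (auto intro!: pochhammer_pos)
  \<comment> \<open>\<open>r n\<close> is the coefficient of \<open>cosh (z / q)\<close> divided by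
    the corresponding coefficient of \<open>hyp01 a (z\<^sup>2 / 4)\<close>.\<close>
  define r where "r n = pochhammer a n / (q\<^sup>2 ^ n * pochhammer (1/2) n)" for n
  have rpos: "r n > 0" for n using assms by (auto simp: r_def)
  have q2: "q\<^sup>2 > 1" using assms by (simp add: one_less_power)
  \<comment> \<open>From this index on \<open>a + real n\<close> is at most
    \<open>q\<^sup>2 * real n\<close>, hence \<open>r\<close> no longer increases and is bounded by
    its maximum over \<open>{..N}\<close>.\<close>
  obtain N :: nat where N: "real N \<ge> a / (q\<^sup>2 - 1)" using real_arch_simple by blast
  have step: "r (Suc n) \<le> r n" if "n \<ge> N" for n
  proof -
    have "a / (q\<^sup>2 - 1) \<le> real n" using N that by linarith
    hence "a + real n \<le> q\<^sup>2 * real n" using q2 by (simp add: field_simps)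
    also have "\<dots> \<le> q\<^sup>2 * (1/2 + real n)" using q2 by (intro mult_left_mono) auto
    finally have *: "(a + real n) / (q\<^sup>2 * (1/2 + real n)) \<le> 1"
      using q2 by (subst divide_le_eq_1_pos) (auto intro!: mult_pos_pos)
    have "r (Suc n) = r n * ((a + real n) / (q\<^sup>2 * (1/2 + real n)))"
      by (simp add: r_def pochhammer_Suc mult_ac)
    also have "\<dots> \<le> r n * 1" using * rpos[of n] by (intro mult_left_mono) auto
    finally show ?thesis by simp
  qed
  define R where "R = Max (r ` {..N})"
  have Rle: "r n \<le> R" for n
  proof (cases "n \<le> N")
    case False
    have "r (N + j) \<le> r N" for j
    proof (induction j)
      case (Suc j)
      thus ?case using step[of "N + j"] by simp
    qed simp
    from this[of "n - N"] have "r n \<le> r N" using False by simp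
    also have "\<dots> \<le> R" unfolding R_def by (intro Max_ge) auto
    finally show ?thesis .
  qed (auto simp: R_def intro!: Max_ge)
  have Rpos: "R > 0" using Rle[of 0] rpos[of 0] by linarith
  show ?thesis
  \<comment> \<open>The 2 comes from \<open>exp u \<le> 2 * cosh u\<close>, the \<open>R\<close>
    from the bound on the coefficient quotients.\<close>
  proof (rule that[of "1 / (2 * R)"])
    fix z :: real assume z: "z \<ge> 0"
    let ?u = "z / q"
    have s: "summable (\<lambda>n. ?u ^ (2*n) / fact (2*n))" "cosh ?u = (\<Sum>n. ?u ^ (2*n) / fact (2*n))"
      using cosh_sums_even[of ?u] by (auto simp: sums_iff)
    have "1 / (2 * R) * exp ?u \<le> 1 / R * cosh ?u"
      using Rpos by (simp add: cosh_def field_simps)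
    also have "\<dots> = (\<Sum>n. 1 / R * (?u ^ (2*n) / fact (2*n)))"
      unfolding s(2) by (rule suminf_mult[symmetric, OF s(1)])
    also have "\<dots> \<le> hyp01 a (z\<^sup>2 / 4)" unfolding hyp01_def
    proof (rule suminf_le[OF _ summable_mult[OF s(1)] summable_hyp01])
      fix n
      have "1 / R \<le> 1 / r n" using Rle[of n] rpos[of n] Rpos by (simp add: field_simps)
      hence "1 / R * (?u ^ (2*n) / fact (2*n)) \<le> 1 / r n * (?u ^ (2*n) / fact (2*n))"
        using z assms by (intro mult_right_mono) auto
      also have "\<dots> = (z\<^sup>2 / 4) ^ n / (fact n * pochhammer a n)"
        unfolding pochhammer_half[symmetric] r_def power_mult[of "z / q" 2 n] power_divide
        using assms pos[of n] by (simp add: power_mult[symmetric] del: pos)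
      finally show "1 / R * (?u ^ (2*n) / fact (2*n)) \<le> (z\<^sup>2 / 4) ^ n / (fact n * pochhammer a n)" .
    qed (use assms in auto)
    finally show "1 / (2 * R) * exp ?u \<le> hyp01 a (z\<^sup>2 / 4)" .
  qed (use Rpos in auto)
qed

text \<open>Vandermonde's convolution for the upper index \<open>real n + (a + real m - 1)\<close>.
  Terms with \<open>l\<close> above \<open>n\<close> vanish because \<open>real n gchoose l\<close>
  does, whence the guard. In Weber's formula \<open>l\<close> becomes the power of
  \<open>A * B\<close>.\<close>

lemma pochhammer_linearization:
  fixes a :: real
  assumes "a > 0"
  shows "pochhammer a (n + m) / (fact n * fact m * pochhammer a n * pochhammer a m) =
    (\<Sum>l\<le>m. if l \<le> n then 1 / (fact l * fact (n - l) * fact (m - l) * pochhammer a l) else 0)"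
proof -
  have pos: "pochhammer a n \<noteq> 0" for n using pochhammer_pos[OF assms, of n] by simp
  have "pochhammer (a + real n) m / fact m = ((real n + (a + real m - 1)) gchoose m)"
    by (simp add: gbinomial_pochhammer' algebra_simps)
  also have "\<dots> = (\<Sum>l\<le>m. (real n gchoose l) * ((a + real m - 1) gchoose (m - l)))"
    by (simp add: gbinomial_Vandermonde[symmetric] atLeast0AtMost)
  also have "\<dots> = (\<Sum>l\<le>m. if l \<le> n then fact n * pochhammer a m /
      (fact l * fact (n - l) * fact (m - l) * pochhammer a l) else 0)"
  proof (rule sum.cong[OF refl], clarsimp, intro conjI impI)
    fix l assume "l \<le> m" "l \<le> n"
    have "(a + real m - 1) gchoose (m - l) = pochhammer (a + real l) (m - l) / fact (m - l)"
      using \<open>l \<le> m\<close> by (simp add: gbinomial_pochhammer' of_nat_diff)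
    moreover have "pochhammer a m = pochhammer a l * pochhammer (a + real l) (m - l)"
      using \<open>l \<le> m\<close> by (rule pochhammer_product)
    moreover have "(real n gchoose l) = fact n / (fact l * fact (n - l))"
      using \<open>l \<le> n\<close> by (simp add: binomial_gbinomial[symmetric] binomial_fact)
    ultimately show "(real n gchoose l) * ((a + real m - 1) gchoose (m - l)) = fact n * pochhammer a m /
      (fact l * fact (n - l) * fact (m - l) * pochhammer a l)"
      using pos[of l] by simp
  qed (auto simp: binomial_gbinomial[symmetric])
  also have "\<dots> = fact n * pochhammer a m * (\<Sum>l\<le>m. if l \<le> n then 1 /
      (fact l * fact (n - l) * fact (m - l) * pochhammer a l) else 0)"
    unfolding sum_distrib_left by (intro sum.cong) auto
  finally have "pochhammer (a + real n) m / fact m / (fact n * pochhammer a m) =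
     (\<Sum>l\<le>m. if l \<le> n then 1 / (fact l * fact (n - l) * fact (m - l) * pochhammer a l) else 0)"
    using pos[of m] by simp
  moreover have "pochhammer a (n + m) = pochhammer a n * pochhammer (a + real n) m"
    by (rule pochhammer_product')
  ultimately show ?thesis using pos[of n] pos[of m] by (simp add: field_simps)
qed

lemma suminf_swap_ennreal:
  fixes f :: "nat \<Rightarrow> nat \<Rightarrow> ennreal"
  shows "(\<Sum>i. \<Sum>j. f i j) = (\<Sum>j. \<Sum>i. f i j)"
proof -
  have "(\<Sum>i. \<Sum>j. f i j) = (\<integral>\<^sup>+i. (\<Sum>j. f i j) \<partial>count_space UNIV)"
    by (simp add: nn_integral_count_space_nat)
  also have "\<dots> = (\<Sum>j. \<integral>\<^sup>+i. f i j \<partial>count_space UNIV)"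
    by (rule nn_integral_suminf) auto
  finally show ?thesis by (simp add: nn_integral_count_space_nat)
qed

lemma suminf_shift_ennreal:
  fixes f :: "nat \<Rightarrow> ennreal"
  shows "(\<Sum>n. if l \<le> n then f (n - l) else 0) = (\<Sum>n. f n)"
  by (subst suminf_offset[of _ l]) auto

text \<open>Euler's integral at \<open>a + real n\<close>. These moments are what remains of Weber's
  integral once both \<open>hyp01\<close> series are integrated term by term.\<close>

lemma nn_integral_gamma_powr:
  assumes "a > 0"
  shows "(\<integral>\<^sup>+z. ennreal (indicator {0<..} z * z powr (a - 1) * exp (-z) * z ^ n) \<partial>lborel) =
     ennreal (Gamma a * pochhammer a n)"
proof -
  have "(\<integral>\<^sup>+z. ennreal (indicator {0<..} z * z powr (a - 1) * exp (-z) * z ^ n) \<partial>lborel) =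
    (\<integral>\<^sup>+z. ennreal (indicator {0..} z * z powr (a + real n - 1) / exp z) \<partial>lborel)"
    by (intro nn_integral_cong)
       (auto simp: indicator_def powr_add powr_diff powr_realpow exp_minus field_simps)
  also have "\<dots> = Gamma (a + real n)"
    using assms by (subst Gamma_conv_nn_integral_real) auto
  also have "Gamma (a + real n) = Gamma a * pochhammer a n"
  proof -
    have "a \<notin> \<int>\<^sub>\<le>\<^sub>0" using assms nonpos_Ints_nonpos[of a] by auto
    thus ?thesis using pochhammer_Gamma[of a n] Gamma_real_pos[OF assms] by simp
  qed
  finally show ?thesis .
qed

lemma ennreal_hyp01_mult:
  assumes "a > 0" "w \<ge> 0" "c \<ge> 0"
  shows "ennreal (c * hyp01 a w) = (\<Sum>n. ennreal (c * (w ^ n / (fact n * pochhammer a n))))"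
  unfolding hyp01_def suminf_mult[OF summable_hyp01[OF assms(1)], symmetric]
  using assms
  by (intro suminf_ennreal2[symmetric] summable_mult summable_hyp01)
     (auto intro!: divide_nonneg_nonneg mult_nonneg_nonneg less_imp_le[OF pochhammer_pos])

text \<open>Weber's second exponential integral, in the variable \<open>z = y\<^sup>2 / (2 t)\<close>. Comparing
  coefficients reduces it to the Vandermonde identity in \<open>pochhammer_linearization\<close>.\<close>

lemma nn_integral_gamma_hyp01_hyp01:
  assumes a: "a > 0" and A: "A \<ge> 0" and B: "B \<ge> 0"
  shows "(\<integral>\<^sup>+z. ennreal (indicator {0<..} z * z powr (a - 1) * exp (-z) * hyp01 a (A * z) * hyp01 a (B * z))
      \<partial>lborel) = ennreal (Gamma a * exp (A + B) * hyp01 a (A * B))"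
proof -
  let ?c = "\<lambda>n. fact n * pochhammer a n"
  let ?w = "\<lambda>z. indicator {0<..} z * z powr (a - 1) * exp (-z) :: real"
  have pos [simp]: "pochhammer a n > 0" "pochhammer a n \<ge> 0" "pochhammer a n \<noteq> 0" for n
    using pochhammer_pos[OF a, of n] by auto
  have G: "Gamma a > 0" using a by simp
  have F0: "w \<ge> 0 \<Longrightarrow> hyp01 a w \<ge> 0" for w using hyp01_ge_1[OF a, of w] by simp
  have "(\<integral>\<^sup>+z. ennreal (?w z * hyp01 a (A * z) * hyp01 a (B * z)) \<partial>lborel) =
     (\<integral>\<^sup>+z. (\<Sum>n. \<Sum>m. ennreal (A ^ n * B ^ m / (?c n * ?c m)) * ennreal (?w z * z ^ (n + m))) \<partial>lborel)"
  proof (rule nn_integral_cong)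
    fix z :: real
    show "ennreal (?w z * hyp01 a (A * z) * hyp01 a (B * z)) =
      (\<Sum>n. \<Sum>m. ennreal (A ^ n * B ^ m / (?c n * ?c m)) * ennreal (?w z * z ^ (n + m)))"
    proof (cases "z > 0")
      case True
      have "ennreal (?w z * hyp01 a (A * z) * hyp01 a (B * z)) =
        ennreal ((?w z * hyp01 a (B * z)) * hyp01 a (A * z))" by (simp add: mult_ac)
      also have "\<dots> = (\<Sum>n. ennreal ((?w z * hyp01 a (B * z)) * ((A * z) ^ n / ?c n)))"
        using True A B F0 by (intro ennreal_hyp01_mult a) auto
      also have "\<dots> = (\<Sum>n. ennreal (?w z * ((A * z) ^ n / ?c n) * hyp01 a (B * z)))"
        by (simp add: mult_ac)
      also have "\<dots> = (\<Sum>n. \<Sum>m. ennreal (?w z * ((A * z) ^ n / ?c n) * ((B * z) ^ m / ?c m)))"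
        using True A B by (intro suminf_cong ennreal_hyp01_mult a) auto
      also have "\<dots> = (\<Sum>n. \<Sum>m. ennreal (A ^ n * B ^ m / (?c n * ?c m)) * ennreal (?w z * z ^ (n + m)))"
        using True A B
        by (intro suminf_cong) (auto simp: ennreal_mult[symmetric] power_mult_distrib power_add field_simps)
      finally show ?thesis .
    qed auto
  qed
  also have "\<dots> = (\<Sum>n. \<Sum>m. ennreal (A ^ n * B ^ m / (?c n * ?c m)) * ennreal (Gamma a * pochhammer a (n + m)))"
    using nn_integral_gamma_powr[OF a]
    by (subst nn_integral_suminf, simp)
       (intro suminf_cong, subst nn_integral_suminf, simp, intro suminf_cong,
        subst nn_integral_cmult, auto)
  \<comment> \<open>The guards \<open>l \<le> n\<close> and \<open>l \<le> m\<close> turn the finite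
    linearization sum into an infinite one, so that the summation over \<open>l\<close> can be moved
    outside.\<close>
  also have "\<dots> = (\<Sum>n. \<Sum>m. \<Sum>l. if l \<le> n then (if l \<le> m then
      ennreal (Gamma a * A ^ n * B ^ m * (1 / (fact l * fact (n - l) * fact (m - l) * pochhammer a l))) else 0) else 0)"
  proof (intro suminf_cong)
    fix n m
    let ?t = "\<lambda>l. if l \<le> n then Gamma a * A ^ n * B ^ m * (1 / (fact l * fact (n - l) * fact (m - l) * pochhammer a l)) else 0"
    have "ennreal (A ^ n * B ^ m / (?c n * ?c m)) * ennreal (Gamma a * pochhammer a (n + m)) =
       ennreal (Gamma a * A ^ n * B ^ m * (pochhammer a (n + m) / (fact n * fact m * pochhammer a n * pochhammer a m)))"
      using A B G by (subst ennreal_mult[symmetric]) (auto simp: field_simps)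
    also have "\<dots> = ennreal (\<Sum>l\<le>m. ?t l)"
      unfolding pochhammer_linearization[OF a] sum_distrib_left
      by (intro arg_cong[where f = ennreal] sum.cong) auto
    also have "\<dots> = (\<Sum>l\<le>m. ennreal (?t l))"
      using A B G by (intro sum_ennreal[symmetric]) auto
    also have "\<dots> = (\<Sum>l. if l \<le> m then ennreal (?t l) else 0)"
      by (subst suminf_finite[of "{..m}"]) auto
    also have "\<dots> = (\<Sum>l. if l \<le> n then (if l \<le> m then
      ennreal (Gamma a * A ^ n * B ^ m * (1 / (fact l * fact (n - l) * fact (m - l) * pochhammer a l))) else 0) else 0)"
      by (intro suminf_cong) auto
    finally show "ennreal (A ^ n * B ^ m / (?c n * ?c m)) * ennreal (Gamma a * pochhammer a (n + m)) = \<dots>" .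
  qed
  also have "\<dots> = (\<Sum>n. \<Sum>l. if l \<le> n then (\<Sum>m. if l \<le> m then
      ennreal (Gamma a * A ^ n * B ^ m * (1 / (fact l * fact (n - l) * fact (m - l) * pochhammer a l))) else 0) else 0)"
    by (subst suminf_swap_ennreal) (intro suminf_cong, auto)
  \<comment> \<open>Splitting the exponents as \<open>(n - l) + l\<close> makes the summand a
    function of \<open>n - l\<close> and \<open>m - l\<close>, the form that
    \<open>suminf_shift_ennreal\<close> expects.\<close>
  also have "\<dots> = (\<Sum>l. \<Sum>n. if l \<le> n then (\<Sum>m. if l \<le> m then
      ennreal (Gamma a * A ^ ((n - l) + l) * B ^ ((m - l) + l) * (1 / (fact l * fact (n - l) * fact (m - l) * pochhammer a l))) else 0) else 0)"
    by (subst suminf_swap_ennreal) (intro suminf_cong if_cong, auto)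
  also have "\<dots> = (\<Sum>l. \<Sum>n. \<Sum>m. ennreal (Gamma a * A ^ (n + l) * B ^ (m + l) * (1 / (fact l * fact n * fact m * pochhammer a l))))"
    unfolding suminf_shift_ennreal[of _ "\<lambda>m. ennreal (Gamma a * A ^ (n - l + l) * B ^ (m + l) * (1 / (fact l * fact (n - l) * fact m * pochhammer a l)))" for n l]
    unfolding suminf_shift_ennreal[of l "\<lambda>n. \<Sum>m. ennreal (Gamma a * A ^ (n + l) * B ^ (m + l) * (1 / (fact l * fact n * fact m * pochhammer a l)))" for l] ..
  \<comment> \<open>After the shifts the triple series factors into exponential series in
    \<open>A\<close> and in \<open>B\<close> and the \<open>hyp01\<close> series in
    \<open>A * B\<close>.\<close>
  also have "\<dots> = (\<Sum>l. \<Sum>n. \<Sum>m. ennreal (Gamma a * ((A * B) ^ l / ?c l) * (A ^ n / fact n)) * ennreal (B ^ m / fact m))"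
    using A B G by (intro suminf_cong) (auto simp: ennreal_mult[symmetric] power_mult_distrib power_add field_simps)
  also have "\<dots> = (\<Sum>l. \<Sum>n. ennreal (Gamma a * ((A * B) ^ l / ?c l) * (A ^ n / fact n)) * ennreal (exp B))"
    using B exp_converges[of B] by (subst ennreal_suminf_cmult, subst suminf_ennreal2)
       (auto simp: sums_iff divide_inverse mult_ac)
  also have "\<dots> = (\<Sum>l. \<Sum>n. ennreal (Gamma a * ((A * B) ^ l / ?c l) * exp B) * ennreal (A ^ n / fact n))"
    using A B G by (intro suminf_cong) (auto simp: ennreal_mult[symmetric] mult_ac)
  also have "\<dots> = (\<Sum>l. ennreal (Gamma a * ((A * B) ^ l / ?c l) * exp B) * ennreal (exp A))"
    using A exp_converges[of A] by (subst ennreal_suminf_cmult, subst suminf_ennreal2)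
       (auto simp: sums_iff divide_inverse mult_ac)
  also have "\<dots> = (\<Sum>l. ennreal (Gamma a * exp (A + B) * ((A * B) ^ l / ?c l)))"
    using A B G by (intro suminf_cong) (auto simp: ennreal_mult[symmetric] exp_add mult_ac)
  also have "\<dots> = ennreal (Gamma a * exp (A + B) * hyp01 a (A * B))"
    using A B G by (intro ennreal_hyp01_mult[symmetric] a) auto
  finally show ?thesis .
qed

subsection \<open>Transition densities\<close>

text \<open>Substitution on the compact intervals \<open>{0..real (Suc n)}\<close>, followed by
  monotone convergence on both sides. The open and the closed half-line differ by a null
  set.\<close>

lemma nn_integral_substitution_square:
  fixes F :: "real \<Rightarrow> ennreal"
  assumes [measurable]: "F \<in> borel_measurable borel" and t: "t > 0"
  shows "(\<integral>\<^sup>+y. F (y\<^sup>2 / (2 * t)) * ennreal (y / t) * indicator {0<..} y \<partial>lborel) =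
    (\<integral>\<^sup>+z. F z * indicator {0<..} z \<partial>lborel)"
proof -
  have SUP_ind: "(SUP n. h * indicator {0..b n} y) = h * indicator {0..} y"
    if "filterlim b at_top sequentially" for h :: ennreal and b :: "nat \<Rightarrow> real" and y
  proof (cases "y \<ge> 0")
    case True
    have "eventually (\<lambda>n. b n \<ge> y) sequentially" using that by (auto simp: filterlim_at_top)
    then obtain n where "b n \<ge> y" by (auto simp: eventually_sequentially)
    thus ?thesis using True
      by (intro antisym SUP_least SUP_upper2[of n]) (auto simp: indicator_def)
  qed (auto simp: indicator_def)
  have suc: "filterlim (\<lambda>n. real (Suc n)) at_top sequentially"
    by (rule filterlim_compose[OF filterlim_real_sequentially filterlim_Suc])
  have "filterlim (\<lambda>n. 1 / (2 * t) * (real (Suc n))\<^sup>2) at_top sequentially"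
    using t by (intro filterlim_tendsto_pos_mult_at_top[OF tendsto_const] filterlim_pow_at_top suc) auto
  hence b: "filterlim (\<lambda>n. (real (Suc n))\<^sup>2 / (2 * t)) at_top sequentially"
    by simp
  have fin: "(\<integral>\<^sup>+z. F z * indicator {0..(real (Suc n))\<^sup>2 / (2 * t)} z \<partial>lborel) =
      (\<integral>\<^sup>+y. F (y\<^sup>2 / (2 * t)) * ennreal (y / t) * indicator {0..real (Suc n)} y \<partial>lborel)" for n
  proof -
    have "((\<lambda>y. y\<^sup>2 / (2 * t)) has_real_derivative y / t) (at y)" for y
      using t by (auto intro!: derivative_eq_intros)
    moreover have "continuous_on {0..real (Suc n)} (\<lambda>y. y / t)"
      using t by (intro continuous_intros) auto
    ultimately show ?thesis
      using nn_integral_substitution_aux[of F 0 "real (Suc n)" "\<lambda>y. y\<^sup>2 / (2 * t)" "\<lambda>y. y / t"] t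
      by (simp del: of_nat_Suc)
  qed
  have "(\<integral>\<^sup>+z. F z * indicator {0<..} z \<partial>lborel) = (\<integral>\<^sup>+z. F z * indicator {0..} z \<partial>lborel)"
    using AE_lborel_singleton[of 0] by (intro nn_integral_cong_AE) (auto simp: indicator_def)
  also have "\<dots> = (\<integral>\<^sup>+z. (SUP n. F z * indicator {0..(real (Suc n))\<^sup>2 / (2 * t)} z) \<partial>lborel)"
    by (subst SUP_ind[OF b]) simp
  also have "\<dots> = (SUP n. \<integral>\<^sup>+z. F z * indicator {0..(real (Suc n))\<^sup>2 / (2 * t)} z \<partial>lborel)"
  proof (rule nn_integral_monotone_convergence_SUP)
    show "incseq (\<lambda>n z. F z * indicator {0..(real (Suc n))\<^sup>2 / (2 * t)} z)"
    proof (intro incseq_SucI le_funI mult_left_mono)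
      fix n and z :: real
      have "(real (Suc n))\<^sup>2 / (2 * t) \<le> (real (Suc (Suc n)))\<^sup>2 / (2 * t)"
        using t by (intro divide_right_mono power_mono) auto
      thus "(indicator {0..(real (Suc n))\<^sup>2 / (2 * t)} z :: ennreal) \<le> indicator {0..(real (Suc (Suc n)))\<^sup>2 / (2 * t)} z"
        by (auto simp: indicator_def simp del: of_nat_Suc)
    qed auto
  qed auto
  also have "\<dots> = (SUP n. \<integral>\<^sup>+y. F (y\<^sup>2 / (2 * t)) * ennreal (y / t) * indicator {0..real (Suc n)} y \<partial>lborel)"
    by (simp only: fin)
  also have "\<dots> = (\<integral>\<^sup>+y. (SUP n. F (y\<^sup>2 / (2 * t)) * ennreal (y / t) * indicator {0..real (Suc n)} y) \<partial>lborel)"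
  proof (rule nn_integral_monotone_convergence_SUP[symmetric])
    show "incseq (\<lambda>n y. F (y\<^sup>2 / (2 * t)) * ennreal (y / t) * indicator {0..real (Suc n)} y)"
      by (intro incseq_SucI le_funI mult_left_mono) (auto simp: indicator_def)
  qed auto
  also have "\<dots> = (\<integral>\<^sup>+y. F (y\<^sup>2 / (2 * t)) * ennreal (y / t) * indicator {0..} y \<partial>lborel)"
    by (subst SUP_ind[OF suc]) simp
  also have "\<dots> = (\<integral>\<^sup>+y. F (y\<^sup>2 / (2 * t)) * ennreal (y / t) * indicator {0<..} y \<partial>lborel)"
    using AE_lborel_singleton[of 0] by (intro nn_integral_cong_AE) (auto simp: indicator_def)
  finally show ?thesis ..
qed

text \<open>The integrand of \<open>bessel_kernel\<close> with its prefactor, after rewriting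
  \<open>bessel_J\<close> by \<open>hyp01\<close>. The indicator restricts it to the open half-line;
  at the origin \<open>y powr (2 * k)\<close> is 0 anyway.\<close>

definition bessel_density :: "real \<Rightarrow> real \<Rightarrow> real \<Rightarrow> real \<Rightarrow> real \<Rightarrow> real" where
  "bessel_density lam k t x y = indicator {0<..} y *
     (exp (- (lam\<^sup>2 * t / 2)) / (2 powr (k - 1 / 2) * Gamma (k + 1 / 2) * t powr (k + 1 / 2)) *
      (exp (- ((x\<^sup>2 + y\<^sup>2) / (2 * t))) *
       (hyp01 (k + 1 / 2) ((x * y / t)\<^sup>2 / 4) * hyp01 (k + 1 / 2) ((y * lam)\<^sup>2 / 4) /
         hyp01 (k + 1 / 2) ((x * lam)\<^sup>2 / 4)) *
       y powr (2 * k)))"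

text \<open>The h-function of the Doob transform that replaces drift \<open>lam\<close> by drift
  \<open>mu\<close>.\<close>

definition bessel_ratio :: "real \<Rightarrow> real \<Rightarrow> real \<Rightarrow> real \<Rightarrow> real" where
  "bessel_ratio k mu lam x = hyp01 (k + 1 / 2) ((x * mu)\<^sup>2 / 4) / hyp01 (k + 1 / 2) ((x * lam)\<^sup>2 / 4)"

context
  fixes k :: real
  assumes k: "k \<ge> 0"
begin

lemma hyp01_pos: "w \<ge> 0 \<Longrightarrow> hyp01 (k + 1 / 2) w > 0"
  using hyp01_ge_1[of "k + 1 / 2" w] k by simp

lemma bessel_density_nonneg: "t > 0 \<Longrightarrow> bessel_density lam k t x y \<ge> 0"
  unfolding bessel_density_def using k hyp01_pos
  by (intro mult_nonneg_nonneg divide_nonneg_nonneg) (auto intro!: less_imp_le[OF hyp01_pos] Gamma_real_nonneg)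

lemma borel_measurable_bessel_density [measurable]:
  assumes "f \<in> borel_measurable M" "g \<in> borel_measurable M"
  shows "(\<lambda>\<omega>. bessel_density lam k t (f \<omega>) (g \<omega>)) \<in> borel_measurable M"
proof -
  note [measurable] = assms borel_measurable_hyp01
  have "k + 1 / 2 > 0" using k by simp
  thus ?thesis unfolding bessel_density_def by measurable
qed

text \<open>In the variable \<open>y\<^sup>2 / (2 * t)\<close> the transition density becomes the
  normalised integrand of Weber's integral. Both the total mass of the kernel and the law of
  \<open>(X t \<omega>)\<^sup>2 / (2 * t)\<close> are read off from this form.\<close>

lemma bessel_density_substitution:
  fixes x lam :: real
  assumes t: "t > 0" and [measurable]: "G \<in> borel_measurable borel"
  defines "A \<equiv> x\<^sup>2 / (2 * t)" and "B \<equiv> lam\<^sup>2 * t / 2" and "a \<equiv> k + 1 / 2"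
  shows "(\<integral>\<^sup>+y. ennreal (bessel_density lam k t x y) * G (y\<^sup>2 / (2 * t)) \<partial>lborel) =
    (\<integral>\<^sup>+z. ennreal (exp (- (A + B)) / (Gamma a * hyp01 a (A * B)) *
       (indicator {0<..} z * z powr (a - 1) * exp (-z) * hyp01 a (A * z) * hyp01 a (B * z))) * G z \<partial>lborel)"
proof -
  have a: "a > 0" using k by (simp add: a_def)
  note [measurable] = borel_measurable_hyp01[OF a]
  let ?F = "\<lambda>z. ennreal (exp (- (A + B)) / (Gamma a * hyp01 a (A * B)) *
       (z powr (a - 1) * exp (-z) * hyp01 a (A * z) * hyp01 a (B * z))) * G z"
  have "(\<integral>\<^sup>+z. ennreal (exp (- (A + B)) / (Gamma a * hyp01 a (A * B)) *
       (indicator {0<..} z * z powr (a - 1) * exp (-z) * hyp01 a (A * z) * hyp01 a (B * z))) * G z \<partial>lborel)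
     = (\<integral>\<^sup>+z. ?F z * indicator {0<..} z \<partial>lborel)"
    by (intro nn_integral_cong) (auto simp: indicator_def)
  also have "\<dots> = (\<integral>\<^sup>+y. ?F (y\<^sup>2 / (2 * t)) * ennreal (y / t) * indicator {0<..} y \<partial>lborel)"
    using t by (intro nn_integral_substitution_square[symmetric]) auto
  also have "\<dots> = (\<integral>\<^sup>+y. ennreal (bessel_density lam k t x y) * G (y\<^sup>2 / (2 * t)) \<partial>lborel)"
  proof (rule nn_integral_cong)
    fix y :: real
    show "?F (y\<^sup>2 / (2 * t)) * ennreal (y / t) * indicator {0<..} y =
      ennreal (bessel_density lam k t x y) * G (y\<^sup>2 / (2 * t))"
    proof (cases "y > 0")
      case True
      have 1: "A * (y\<^sup>2 / (2 * t)) = (x * y / t)\<^sup>2 / 4" "B * (y\<^sup>2 / (2 * t)) = (y * lam)\<^sup>2 / 4"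
        "A * B = (x * lam)\<^sup>2 / 4"
        using t by (auto simp: A_def B_def field_simps power2_eq_square)
      have 2: "exp (- (A + B)) * exp (- (y\<^sup>2 / (2 * t))) = exp (- (lam\<^sup>2 * t / 2)) * exp (- ((x\<^sup>2 + y\<^sup>2) / (2 * t)))"
        using t by (simp add: exp_add[symmetric] A_def B_def add_divide_distrib)
      \<comment> \<open>The Jacobian \<open>y / t\<close> raises the power \<open>2 * k - 1\<close>
        of \<open>y\<close> to \<open>2 * k\<close> and completes the powers of 2 and
        \<open>t\<close> in the normalising constant.\<close>
      have 3: "(y\<^sup>2 / (2 * t)) powr (a - 1) * (y / t) = y powr (2 * k) / (2 powr (k - 1/2) * t powr (k + 1/2))"
      proof -
        have "(y\<^sup>2 / (2 * t)) powr (a - 1) = y powr (2 * (k - 1/2)) / (2 powr (k - 1/2) * t powr (k - 1/2))"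
          using True t by (simp add: a_def powr_divide powr_mult powr_powr flip: powr_numeral)
        also have "y powr (2 * (k - 1/2)) = y powr (2 * k) / y"
          using True by (simp add: powr_diff algebra_simps)
        also have "t powr (k - 1/2) = t powr (k + 1/2) / t"
        proof -
          have "t powr (k + 1/2 - 1) = t powr (k + 1/2) / t" using t by (subst powr_diff) auto
          thus ?thesis by simp
        qed
        finally show ?thesis using True t by simp
      qed
      have "?F (y\<^sup>2 / (2 * t)) * ennreal (y / t) * indicator {0<..} y =
        ennreal (exp (- (A + B)) / (Gamma a * hyp01 a (A * B)) *
          ((y\<^sup>2 / (2 * t)) powr (a - 1) * exp (- (y\<^sup>2 / (2 * t))) * hyp01 a (A * (y\<^sup>2 / (2 * t))) * hyp01 a (B * (y\<^sup>2 / (2 * t)))) *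
          (y / t)) * G (y\<^sup>2 / (2 * t))"
        using True t by (subst ennreal_mult'') (auto simp: mult_ac)
      also have "exp (- (A + B)) / (Gamma a * hyp01 a (A * B)) *
          ((y\<^sup>2 / (2 * t)) powr (a - 1) * exp (- (y\<^sup>2 / (2 * t))) * hyp01 a (A * (y\<^sup>2 / (2 * t))) * hyp01 a (B * (y\<^sup>2 / (2 * t)))) *
          (y / t) = (exp (- (A + B)) * exp (- (y\<^sup>2 / (2 * t)))) * ((y\<^sup>2 / (2 * t)) powr (a - 1) * (y / t)) *
          (hyp01 a (A * (y\<^sup>2 / (2 * t))) * hyp01 a (B * (y\<^sup>2 / (2 * t)))) / (Gamma a * hyp01 a (A * B))"
        by (simp add: mult_ac)
      also have "\<dots> = bessel_density lam k t x y"
        unfolding 1 2 3 using True by (simp add: bessel_density_def a_def mult_ac)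
      finally show ?thesis .
    qed (auto simp: bessel_density_def)
  qed
  finally show ?thesis ..
qed

text \<open>Weber's integral is exactly the reciprocal of the prefactor, so the kernels are
  probability kernels.\<close>

lemma nn_integral_bessel_density:
  assumes t: "t > 0"
  shows "(\<integral>\<^sup>+y. ennreal (bessel_density lam k t x y) \<partial>lborel) = 1"
proof -
  define A B a where "A = x\<^sup>2 / (2 * t)" and "B = lam\<^sup>2 * t / 2" and "a = k + 1 / 2"
  have a: "a > 0" and AB: "A \<ge> 0" "B \<ge> 0" using k t by (auto simp: a_def A_def B_def)
  have h: "hyp01 a (A * B) > 0" using hyp01_pos AB by (simp add: a_def)
  have G: "Gamma a > 0" using a by simp
  note [measurable] = borel_measurable_hyp01[OF a]
  let ?c = "exp (- (A + B)) / (Gamma a * hyp01 a (A * B))"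
  have "(\<integral>\<^sup>+y. ennreal (bessel_density lam k t x y) \<partial>lborel) = (\<integral>\<^sup>+z. ennreal (?c *
       (indicator {0<..} z * z powr (a - 1) * exp (-z) * hyp01 a (A * z) * hyp01 a (B * z))) \<partial>lborel)"
    using bessel_density_substitution[OF t, of "\<lambda>_. 1" lam x] by (simp add: A_def B_def a_def)
  also have "\<dots> = (\<integral>\<^sup>+z. ennreal ?c * ennreal
       (indicator {0<..} z * z powr (a - 1) * exp (-z) * hyp01 a (A * z) * hyp01 a (B * z)) \<partial>lborel)"
    using h G by (intro nn_integral_cong ennreal_mult') auto
  also have "\<dots> = ennreal ?c * ennreal (Gamma a * exp (A + B) * hyp01 a (A * B))"
    by (subst nn_integral_cmult) (use nn_integral_gamma_hyp01_hyp01[OF a AB] in auto)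
  also have "\<dots> = ennreal 1"
    using h G by (subst ennreal_mult[symmetric]) (auto simp: exp_add[symmetric])
  finally show ?thesis by simp
qed

text \<open>The kernel is defined by a Bochner integral, which would be 0 for a non-integrable
  function. Finite total mass of the density gives the integrability that identifies it with the
  nonnegative integral.\<close>

lemma bessel_kernel_eq_nn_integral:
  assumes t: "t > 0" and A [measurable]: "A \<in> sets borel" and A0: "A \<subseteq> {0..}"
  shows "ennreal (bessel_kernel lam k t x A) =
    (\<integral>\<^sup>+y. ennreal (bessel_density lam k t x y) * indicator A y \<partial>lborel)"
proof -
  let ?d = "\<lambda>y. bessel_density lam k t x y * indicator A y"
  have le: "(\<integral>\<^sup>+y. ennreal (?d y) \<partial>lborel) \<le> (\<integral>\<^sup>+y. ennreal (bessel_density lam k t x y) \<partial>lborel)"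
    using bessel_density_nonneg[OF t] by (intro nn_integral_mono ennreal_leI) (auto simp: indicator_def)
  have int: "integrable lborel ?d"
    by (rule integrableI_nonneg)
       (use le bessel_density_nonneg[OF t] in \<open>auto simp: nn_integral_bessel_density[OF t] intro: le_less_trans\<close>)
  have "bessel_kernel lam k t x A = (LINT y|lborel. ?d y)"
    unfolding bessel_kernel_def set_lebesgue_integral_def
    by (subst integral_mult_right_zero[symmetric], intro Bochner_Integration.integral_cong refl)
       (use A0 k t in \<open>auto simp: bessel_density_def indicator_def bessel_J_eq_hyp01 not_less mult_ac\<close>)
  also have "ennreal \<dots> = (\<integral>\<^sup>+y. ennreal (?d y) \<partial>lborel)"
    using bessel_density_nonneg[OF t] by (intro nn_integral_eq_integral[symmetric] int) auto
  also have "\<dots> = (\<integral>\<^sup>+y. ennreal (bessel_density lam k t x y) * indicator A y \<partial>lborel)"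
    by (intro nn_integral_cong) (auto simp: indicator_def)
  finally show ?thesis .
qed

lemma bessel_kernel_nonneg:
  assumes "t > 0" "A \<subseteq> {0..}"
  shows "bessel_kernel lam k t x A \<ge> 0"
proof -
  have "Gamma (k + 1/2) > 0" using k by simp
  thus ?thesis unfolding bessel_kernel_def set_lebesgue_integral_def using k assms hyp01_pos
    by (intro mult_nonneg_nonneg Bochner_Integration.integral_nonneg divide_nonneg_nonneg)
       (auto simp: bessel_J_eq_hyp01 intro!: divide_nonneg_nonneg mult_nonneg_nonneg less_imp_le[OF hyp01_pos])
qed


lemma bessel_ratio_pos: "bessel_ratio k mu lam x > 0"
  using hyp01_pos by (simp add: bessel_ratio_def)

lemma borel_measurable_bessel_ratio [measurable]: "bessel_ratio k mu lam \<in> borel_measurable borel"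
proof -
  have "k + 1 / 2 > 0" using k by simp
  note [measurable] = borel_measurable_hyp01[OF this]
  show ?thesis unfolding bessel_ratio_def [abs_def] by measurable
qed

lemma continuous_on_bessel_ratio: "continuous_on UNIV (bessel_ratio k mu lam)"
proof -
  have a: "k + 1 / 2 > 0" using k by simp
  have "hyp01 (k + 1 / 2) ((x * lam)\<^sup>2 / 4) \<noteq> 0" for x
    using hyp01_pos[of "(x * lam)\<^sup>2 / 4"] by simp
  thus ?thesis unfolding bessel_ratio_def [abs_def]
    by (intro continuous_intros continuous_on_hyp01 a) auto
qed

text \<open>Changing the drift is a Doob transform of the transition density.\<close>

lemma bessel_density_ratio:
  "bessel_density lam k t x y * bessel_ratio k mu lam y =
    exp ((mu\<^sup>2 - lam\<^sup>2) * t / 2) * bessel_ratio k mu lam x * bessel_density mu k t x y"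
proof -
  have *: "exp (- (lam\<^sup>2 * t / 2)) = exp ((mu\<^sup>2 - lam\<^sup>2) * t / 2) * exp (- (mu\<^sup>2 * t / 2))"
    by (simp add: exp_add[symmetric] algebra_simps diff_divide_distrib)
  have "hyp01 (k + 1 / 2) ((b * c)\<^sup>2 / 4) \<noteq> 0" for b c
    using hyp01_pos[of "(b * c)\<^sup>2 / 4"] by simp
  thus ?thesis unfolding bessel_density_def bessel_ratio_def * by (simp add: mult_ac)
qed

text \<open>By the Doob transform the integrand is a multiple of the density with drift
  \<open>mu\<close>, which has mass 1. This is the one-step form of the martingale property.\<close>

lemma nn_integral_bessel_density_ratio:
  assumes t: "t > 0"
  shows "(\<integral>\<^sup>+y. ennreal (bessel_density lam k t x y) * ennreal (bessel_ratio k mu lam y) \<partial>lborel) =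
    ennreal (exp ((mu\<^sup>2 - lam\<^sup>2) * t / 2) * bessel_ratio k mu lam x)"
proof -
  let ?c = "exp ((mu\<^sup>2 - lam\<^sup>2) * t / 2) * bessel_ratio k mu lam x"
  have c: "?c \<ge> 0" using less_imp_le[OF bessel_ratio_pos] by simp
  have "(\<integral>\<^sup>+y. ennreal (bessel_density lam k t x y) * ennreal (bessel_ratio k mu lam y) \<partial>lborel) =
    (\<integral>\<^sup>+y. ennreal ?c * ennreal (bessel_density mu k t x y) \<partial>lborel)"
    using bessel_density_nonneg[OF t] less_imp_le[OF bessel_ratio_pos] c
    by (intro nn_integral_cong) (simp only: ennreal_mult[symmetric] bessel_density_ratio)
  also have "\<dots> = ennreal ?c"
    by (subst nn_integral_cmult) (auto simp: nn_integral_bessel_density[OF t])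
  finally show ?thesis .
qed

end

subsection \<open>Martingales and the strong law\<close>

lemma bessel_ratio_0: "bessel_ratio k mu lam 0 = 1"
  by (simp add: bessel_ratio_def)

context bessel_process
begin

lemmas borel_measurable_bessel_density' [measurable] = borel_measurable_bessel_density[OF multiplicity_nonneg]
lemmas borel_measurable_bessel_ratio' [measurable] = borel_measurable_bessel_ratio[OF multiplicity_nonneg]

lemma sets_natural_filtration:
  "sets (natural_filtration M X s) =
    sigma_sets (space M) {X r -` B \<inter> space M | r B. 0 \<le> r \<and> r \<le> s \<and> B \<in> sets borel}"
  unfolding natural_filtration_def by (rule sets_measure_of) auto

lemma space_natural_filtration: "space (natural_filtration M X s) = space M"
  unfolding natural_filtration_def by (rule space_measure_of) auto

lemma subalgebra_natural_filtration: "subalgebra M (natural_filtration M X s)"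
  unfolding subalgebra_def sets_natural_filtration space_natural_filtration
  using measurable_X by (auto intro!: sets.sigma_sets_subset measurable_sets)

lemma measurable_natural_filtration:
  assumes "0 \<le> r" "r \<le> s"
  shows "X r \<in> borel_measurable (natural_filtration M X s)"
proof (rule measurableI)
  fix A :: "real set" assume "A \<in> sets borel"
  thus "X r -` A \<inter> space (natural_filtration M X s) \<in> sets (natural_filtration M X s)"
    unfolding sets_natural_filtration space_natural_filtration using assms by (intro sigma_sets.Basic) auto
qed auto

lemma natural_filtration_sets: "B \<in> sets (natural_filtration M X s) \<Longrightarrow> B \<in> sets M"
  using subalgebra_natural_filtration unfolding subalgebra_def by blast

text \<open>The Markov assumption concerns indicators only. It identifies two measures on the line,
  the law of \<open>X (s + t)\<close> restricted to \<open>B\<close> and the transition density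
  averaged over \<open>B\<close>; integrating \<open>g\<close> against both gives the claim.\<close>

lemma markov_nn_integral:
  assumes s: "s \<ge> 0" and t: "t > 0" and B: "B \<in> sets (natural_filtration M X s)"
    and g [measurable]: "g \<in> borel_measurable borel"
  shows "(\<integral>\<^sup>+\<omega>. g (X (s + t) \<omega>) * indicator B \<omega> \<partial>M) =
    (\<integral>\<^sup>+\<omega>. (\<integral>\<^sup>+y. ennreal (bessel_density lam k t (X s \<omega>) y) * g y \<partial>lborel) * indicator B \<omega> \<partial>M)"
proof -
  note [measurable] = natural_filtration_sets[OF B] measurable_X[OF s]
  have Xst [measurable]: "X (s + t) \<in> borel_measurable M" using s t by (intro measurable_X) simp
  interpret pair_sigma_finite lborel M ..
  interpret finite_measure_subalgebra M "natural_filtration M X s"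
    by unfold_locales (rule subalgebra_natural_filtration)
  let ?p = "\<lambda>\<omega> y. ennreal (bessel_density lam k t (X s \<omega>) y)"
  let ?f = "\<lambda>y. \<integral>\<^sup>+\<omega>. ?p \<omega> y * indicator B \<omega> \<partial>M"
  have f [measurable]: "?f \<in> borel_measurable borel" by measurable
  have swap: "(\<integral>\<^sup>+y. ?f y * h y \<partial>lborel) = (\<integral>\<^sup>+\<omega>. (\<integral>\<^sup>+y. ?p \<omega> y * h y \<partial>lborel) * indicator B \<omega> \<partial>M)"
    if [measurable]: "h \<in> borel_measurable borel" for h
  proof -
    have "(\<integral>\<^sup>+y. ?f y * h y \<partial>lborel) = (\<integral>\<^sup>+y. \<integral>\<^sup>+\<omega>. ?p \<omega> y * h y * indicator B \<omega> \<partial>M \<partial>lborel)"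
      by (intro nn_integral_cong, subst nn_integral_multc[symmetric]) (auto simp: mult_ac)
    also have "\<dots> = (\<integral>\<^sup>+\<omega>. \<integral>\<^sup>+y. ?p \<omega> y * h y * indicator B \<omega> \<partial>lborel \<partial>M)"
      by (rule Fubini'[symmetric]) measurable
    also have "\<dots> = (\<integral>\<^sup>+\<omega>. (\<integral>\<^sup>+y. ?p \<omega> y * h y \<partial>lborel) * indicator B \<omega> \<partial>M)"
      by (intro nn_integral_cong nn_integral_multc) measurable
    finally show ?thesis .
  qed
  have "distr (density M (indicator B)) borel (X (s + t)) = density lborel ?f"
  proof (rule measure_eqI)
    fix A assume "A \<in> sets (distr (density M (indicator B)) borel (X (s + t)))"
    hence [measurable]: "A \<in> sets borel" by simp
    \<comment> \<open>The Markov assumption speaks of subsets of the half-line only. Cutting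
      \<open>A\<close> down changes neither side: the process is nonnegative and the density
      vanishes outside \<open>{0<..}\<close>.\<close>
    define A' where "A' = A \<inter> {0..}"
    have A' [measurable]: "A' \<in> sets borel" "A' \<subseteq> {0..}" by (auto simp: A'_def)
    let ?i = "\<lambda>\<omega>. indicator A' (X (s + t) \<omega>) :: real"
    let ?r = "real_cond_exp M (natural_filtration M X s) ?i"
    have int: "integrable M ?i" by (rule integrable_const_bound[of _ 1]) (auto simp: indicator_def)
    have ae: "AE \<omega> in M. ?r \<omega> = bessel_kernel lam k t (X s \<omega>) A'"
      using s t A' by (intro markov)
    have ae0: "AE \<omega> in M. ?r \<omega> \<ge> 0"
      using ae by eventually_elim (simp add: bessel_kernel_nonneg[OF multiplicity_nonneg t A'(2)])
    have "emeasure (distr (density M (indicator B)) borel (X (s + t))) A =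
        (\<integral>\<^sup>+\<omega>. indicator B \<omega> * indicator (X (s + t) -` A \<inter> space M) \<omega> \<partial>M)"
      by (subst emeasure_distr, simp, simp, subst emeasure_density) auto
    also have "\<dots> = (\<integral>\<^sup>+\<omega>. ennreal (indicator B \<omega> * ?i \<omega>) \<partial>M)"
      using s t nonneg_X[of "s + t"]
      by (intro nn_integral_cong) (auto simp: indicator_def A'_def)
    also have "\<dots> = ennreal (\<integral>\<omega>. indicator B \<omega> * ?i \<omega> \<partial>M)"
      by (rule nn_integral_eq_integral, rule integrable_const_bound[of _ 1]) (auto simp: indicator_def)
    also have "(\<integral>\<omega>. indicator B \<omega> * ?i \<omega> \<partial>M) = (\<integral>\<omega>. indicator B \<omega> * ?r \<omega> \<partial>M)"
      using real_cond_exp_intA[OF int B] by (simp add: set_lebesgue_integral_def)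
    also have "ennreal \<dots> = (\<integral>\<^sup>+\<omega>. ennreal (indicator B \<omega> * ?r \<omega>) \<partial>M)"
    proof (rule nn_integral_eq_integral[symmetric])
      show "integrable M (\<lambda>\<omega>. indicator B \<omega> * ?r \<omega>)"
        using integrable_mult_indicator[OF natural_filtration_sets[OF B] real_cond_exp_int(1)[OF int]] by simp
      show "AE \<omega> in M. 0 \<le> indicator B \<omega> * ?r \<omega>" using ae0 by eventually_elim auto
    qed
    also have "\<dots> = (\<integral>\<^sup>+\<omega>. (\<integral>\<^sup>+y. ?p \<omega> y * indicator A' y \<partial>lborel) * indicator B \<omega> \<partial>M)"
      using ae by (intro nn_integral_cong_AE, eventually_elim)
        (auto simp: indicator_def bessel_kernel_eq_nn_integral[OF multiplicity_nonneg t A', unfolded indicator_def])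
    also have "\<dots> = (\<integral>\<^sup>+y. ?f y * indicator A' y \<partial>lborel)"
      by (rule swap[symmetric]) simp
    also have "\<dots> = (\<integral>\<^sup>+y. ?f y * indicator A y \<partial>lborel)"
      by (intro nn_integral_cong) (auto simp: A'_def indicator_def bessel_density_def)
    also have "\<dots> = emeasure (density lborel ?f) A"
      by (rule emeasure_density[symmetric]) auto
    finally show "emeasure (distr (density M (indicator B)) borel (X (s + t))) A = emeasure (density lborel ?f) A" .
  qed simp
  hence "(\<integral>\<^sup>+y. g y \<partial>distr (density M (indicator B)) borel (X (s + t))) = (\<integral>\<^sup>+y. g y \<partial>density lborel ?f)"
    by simp
  also have "(\<integral>\<^sup>+y. g y \<partial>distr (density M (indicator B)) borel (X (s + t))) =
     (\<integral>\<^sup>+\<omega>. g (X (s + t) \<omega>) * indicator B \<omega> \<partial>M)"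
    by (subst nn_integral_distr, simp, simp, subst nn_integral_density) (auto simp: mult.commute)
  also have "(\<integral>\<^sup>+y. g y \<partial>density lborel ?f) = (\<integral>\<^sup>+y. ?f y * g y \<partial>lborel)"
    by (rule nn_integral_density) auto
  also note swap[OF g]
  finally show ?thesis .
qed

text \<open>Up to its exponential factor this is the density of the law with drift \<open>mu\<close> with respect to
  that with drift \<open>lam\<close>, hence a martingale.\<close>

definition bessel_mart :: "real \<Rightarrow> real \<Rightarrow> 'a \<Rightarrow> real" where
  "bessel_mart mu t \<omega> = exp (- ((mu\<^sup>2 - lam\<^sup>2) * t / 2)) * bessel_ratio k mu lam (X t \<omega>)"

lemma borel_measurable_bessel_mart:
  assumes "0 \<le> r" "r \<le> s"
  shows "bessel_mart mu r \<in> borel_measurable (natural_filtration M X s)"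
proof -
  note [measurable] = measurable_natural_filtration[OF assms]
  show ?thesis unfolding bessel_mart_def [abs_def] by measurable
qed

lemma borel_measurable_bessel_mart' [measurable]:
  assumes "0 \<le> r"
  shows "bessel_mart mu r \<in> borel_measurable M"
  using measurable_from_subalg[OF subalgebra_natural_filtration borel_measurable_bessel_mart[OF assms order_refl]] .

text \<open>The growth factor over the time \<open>t - s\<close> from the one-step identity cancels
  against the deterministic exponential. Nonnegative integrals over sets of the filtration keep the
  identity meaningful for every initial law and are the form used in the maximal inequality.\<close>

lemma bessel_mart_martingale:
  assumes s: "s \<ge> 0" and st: "s \<le> t" and B: "B \<in> sets (natural_filtration M X s)"
  shows "(\<integral>\<^sup>+\<omega>. ennreal (bessel_mart mu t \<omega>) * indicator B \<omega> \<partial>M) =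
    (\<integral>\<^sup>+\<omega>. ennreal (bessel_mart mu s \<omega>) * indicator B \<omega> \<partial>M)"
proof (cases "s = t")
  case False
  define u where "u = t - s"
  have u: "u > 0" "t = s + u" using False st by (auto simp: u_def)
  let ?e = "exp (- ((mu\<^sup>2 - lam\<^sup>2) * t / 2))"
  let ?g = "\<lambda>y. ennreal ?e * ennreal (bessel_ratio k mu lam y)"
  have "(\<integral>\<^sup>+\<omega>. ennreal (bessel_mart mu t \<omega>) * indicator B \<omega> \<partial>M) =
    (\<integral>\<^sup>+\<omega>. ?g (X (s + u) \<omega>) * indicator B \<omega> \<partial>M)"
    using less_imp_le[OF bessel_ratio_pos[OF multiplicity_nonneg]]
    by (intro nn_integral_cong) (simp add: bessel_mart_def ennreal_mult u(2))
  also have "\<dots> = (\<integral>\<^sup>+\<omega>. (\<integral>\<^sup>+y. ennreal (bessel_density lam k u (X s \<omega>) y) * ?g y \<partial>lborel) * indicator B \<omega> \<partial>M)"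
    using s u(1) B by (intro markov_nn_integral) auto
  also have "\<dots> = (\<integral>\<^sup>+\<omega>. ennreal (bessel_mart mu s \<omega>) * indicator B \<omega> \<partial>M)"
  proof (intro nn_integral_cong arg_cong2[where f = "(*)"] refl)
    fix \<omega>
    have "(\<integral>\<^sup>+y. ennreal (bessel_density lam k u (X s \<omega>) y) * ?g y \<partial>lborel) =
      (\<integral>\<^sup>+y. ennreal ?e * (ennreal (bessel_density lam k u (X s \<omega>) y) * ennreal (bessel_ratio k mu lam y)) \<partial>lborel)"
      by (simp add: mult_ac)
    also have "\<dots> = ennreal ?e * ennreal (exp ((mu\<^sup>2 - lam\<^sup>2) * u / 2) * bessel_ratio k mu lam (X s \<omega>))"
      by (subst nn_integral_cmult) (auto simp: nn_integral_bessel_density_ratio[OF multiplicity_nonneg u(1)])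
    also have "\<dots> = ennreal ((?e * exp ((mu\<^sup>2 - lam\<^sup>2) * u / 2)) * bessel_ratio k mu lam (X s \<omega>))"
      using less_imp_le[OF bessel_ratio_pos[OF multiplicity_nonneg]]
      by (subst ennreal_mult[symmetric]) (auto simp: mult_ac)
    also have "?e * exp ((mu\<^sup>2 - lam\<^sup>2) * u / 2) = exp (- ((mu\<^sup>2 - lam\<^sup>2) * s / 2))"
      unfolding exp_add[symmetric] u_def by (simp add: right_diff_distrib diff_divide_distrib)
    finally show "(\<integral>\<^sup>+y. ennreal (bessel_density lam k u (X s \<omega>) y) * ?g y \<partial>lborel) = ennreal (bessel_mart mu s \<omega>)"
      by (simp add: bessel_mart_def)
  qed
  finally show ?thesis .
qed simp

end

locale bessel_process_0 = bessel_process +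
  assumes start_0: "AE \<omega> in M. X 0 \<omega> = 0"
begin

lemma space_in_natural_filtration: "space M \<in> sets (natural_filtration M X s)"
  using sets.top[of "natural_filtration M X s"] by (simp add: space_natural_filtration)

lemma nn_integral_bessel_mart:
  assumes "t \<ge> 0"
  shows "(\<integral>\<^sup>+\<omega>. ennreal (bessel_mart mu t \<omega>) \<partial>M) = 1"
proof -
  have "(\<integral>\<^sup>+\<omega>. ennreal (bessel_mart mu t \<omega>) \<partial>M) = (\<integral>\<^sup>+\<omega>. ennreal (bessel_mart mu t \<omega>) * indicator (space M) \<omega> \<partial>M)"
    by (intro nn_integral_cong) auto
  also have "\<dots> = (\<integral>\<^sup>+\<omega>. ennreal (bessel_mart mu 0 \<omega>) * indicator (space M) \<omega> \<partial>M)"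
    using assms by (intro bessel_mart_martingale space_in_natural_filtration) auto
  also have "\<dots> = (\<integral>\<^sup>+\<omega>. 1 \<partial>M)"
    using start_0 by (intro nn_integral_cong_AE) (auto simp: bessel_mart_def bessel_ratio_0)
  finally show ?thesis by (simp add: emeasure_space_1)
qed

lemma nn_integral_marginal:
  assumes t: "t > 0" and g [measurable]: "g \<in> borel_measurable borel"
  shows "(\<integral>\<^sup>+\<omega>. g (X t \<omega>) \<partial>M) = (\<integral>\<^sup>+y. ennreal (bessel_density lam k t 0 y) * g y \<partial>lborel)"
proof -
  have "(\<integral>\<^sup>+\<omega>. g (X t \<omega>) \<partial>M) = (\<integral>\<^sup>+\<omega>. g (X (0 + t) \<omega>) * indicator (space M) \<omega> \<partial>M)"
    by (intro nn_integral_cong) auto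
  also have "\<dots> = (\<integral>\<^sup>+\<omega>. (\<integral>\<^sup>+y. ennreal (bessel_density lam k t (X 0 \<omega>) y) * g y \<partial>lborel) * indicator (space M) \<omega> \<partial>M)"
    by (intro markov_nn_integral space_in_natural_filtration t g) auto
  also have "\<dots> = (\<integral>\<^sup>+\<omega>. (\<integral>\<^sup>+y. ennreal (bessel_density lam k t 0 y) * g y \<partial>lborel) \<partial>M)"
    using start_0 by (intro nn_integral_cong_AE) auto
  finally show ?thesis by (simp add: emeasure_space_1)
qed

text \<open>Doob's maximal inequality on an equidistant grid, proved by splitting according to the
  first index at which the level \<open>C\<close> is reached. The right-hand side does not depend on
  the mesh or the horizon.\<close>

lemma bessel_mart_maximal:
  assumes h: "h > 0" and C: "C > 0"
  shows "emeasure M {\<omega> \<in> space M. \<exists>i\<le>m. C \<le> bessel_mart mu (real i * h) \<omega>} \<le> ennreal (1 / C)"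
proof -
  let ?N = "\<lambda>i. bessel_mart mu (real i * h)"
  have le: "i \<le> m \<Longrightarrow> real i * h \<le> real m * h" for i m using h by (intro mult_right_mono) auto
  have nn: "real i * h \<ge> 0" for i using h by simp
  \<comment> \<open>\<open>E i\<close> is the event that the level is reached for the first time at
    index \<open>i\<close>. These events are disjoint, and \<open>E i\<close> is decided by time
    \<open>real i * h\<close>.\<close>
  define E where "E i = {\<omega> \<in> space M. C \<le> ?N i \<omega> \<and> (\<forall>j<i. ?N j \<omega> < C)}" for i
  have E: "E i \<in> sets (natural_filtration M X (real i * h))" for i
  proof -
    let ?A = "\<lambda>j. ?N j -` {C..} \<inter> space M"
    have A: "?A j \<in> sets (natural_filtration M X (real i * h))" if "j \<le> i" for j
      using measurable_sets[OF borel_measurable_bessel_mart[OF nn le[OF that]], of "{C..}" mu]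
      by (simp add: space_natural_filtration)
    have "?A i - (\<Union>j\<in>{..<i}. ?A j) \<in> sets (natural_filtration M X (real i * h))"
      using A by (intro sets.Diff sets.finite_UN) auto
    also have "?A i - (\<Union>j\<in>{..<i}. ?A j) = E i" by (auto simp: E_def not_le)
    finally show ?thesis .
  qed
  note EM [measurable] = natural_filtration_sets[OF E]
  have [measurable]: "?N j \<in> borel_measurable M" for j by (intro borel_measurable_bessel_mart' nn)
  have "{\<omega> \<in> space M. \<exists>i\<le>m. C \<le> ?N i \<omega>} \<subseteq> (\<Union>i\<in>{..m}. E i)"
  proof safe
    fix \<omega> i assume \<omega>: "\<omega> \<in> space M" "i \<le> m" "C \<le> ?N i \<omega>"
    define j where "j = (LEAST j. C \<le> ?N j \<omega>)"
    have "C \<le> ?N j \<omega>" unfolding j_def using \<omega>(3) by (rule LeastI)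
    moreover have "\<forall>l<j. ?N l \<omega> < C" unfolding j_def by (meson not_less not_less_Least)
    moreover have "j \<le> i" unfolding j_def using \<omega>(3) by (rule Least_le)
    ultimately show "\<omega> \<in> (\<Union>i\<in>{..m}. E i)" using \<omega> by (auto simp: E_def)
  qed
  hence "emeasure M {\<omega> \<in> space M. \<exists>i\<le>m. C \<le> ?N i \<omega>} \<le> emeasure M (\<Union>i\<in>{..m}. E i)"
    by (intro emeasure_mono) auto
  also have "\<dots> \<le> (\<Sum>i\<le>m. emeasure M (E i))"
    by (intro emeasure_subadditive_finite) auto
  finally have 1: "emeasure M {\<omega> \<in> space M. \<exists>i\<le>m. C \<le> ?N i \<omega>} \<le> (\<Sum>i\<le>m. emeasure M (E i))" .
  have "ennreal C * (\<Sum>i\<le>m. emeasure M (E i)) = (\<Sum>i\<le>m. \<integral>\<^sup>+\<omega>. ennreal C * indicator (E i) \<omega> \<partial>M)"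
    by (simp add: sum_distrib_left nn_integral_cmult_indicator)
  also have "\<dots> \<le> (\<Sum>i\<le>m. \<integral>\<^sup>+\<omega>. ennreal (?N i \<omega>) * indicator (E i) \<omega> \<partial>M)"
    by (intro sum_mono nn_integral_mono) (auto simp: E_def indicator_def intro!: ennreal_leI)
  \<comment> \<open>The martingale property on \<open>E i\<close> moves the value at the first
    passage to the common final index \<open>m\<close>, where the total expectation is 1.\<close>
  also have "\<dots> = (\<Sum>i\<le>m. \<integral>\<^sup>+\<omega>. ennreal (?N m \<omega>) * indicator (E i) \<omega> \<partial>M)"
    by (intro sum.cong refl bessel_mart_martingale[symmetric] E nn le) auto
  also have "\<dots> = (\<Sum>i\<le>m. emeasure (density M (\<lambda>\<omega>. ennreal (?N m \<omega>))) (E i))"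
    by (intro sum.cong refl emeasure_density[symmetric]) auto
  also have "\<dots> = emeasure (density M (\<lambda>\<omega>. ennreal (?N m \<omega>))) (\<Union>i\<in>{..m}. E i)"
  proof (rule sum_emeasure)
    show "disjoint_family_on E {..m}"
      unfolding disjoint_family_on_def
    proof safe
      fix i j \<omega> assume "\<omega> \<in> E i" "\<omega> \<in> E j" "i \<noteq> j"
      thus "\<omega> \<in> {}" by (cases i j rule: linorder_cases) (auto simp: E_def)
    qed
  qed auto
  also have "\<dots> \<le> emeasure (density M (\<lambda>\<omega>. ennreal (?N m \<omega>))) (space M)"
    by (intro emeasure_mono) (auto simp: E_def)
  also have "\<dots> = (\<integral>\<^sup>+\<omega>. ennreal (?N m \<omega>) \<partial>M)"
    by (subst emeasure_density) (auto intro!: nn_integral_cong)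
  also have "\<dots> = 1" by (rule nn_integral_bessel_mart[OF nn])
  finally have "ennreal C * (\<Sum>i\<le>m. emeasure M (E i)) \<le> 1" .
  hence "ennreal (1 / C) * (ennreal C * (\<Sum>i\<le>m. emeasure M (E i))) \<le> ennreal (1 / C) * 1"
    by (intro mult_left_mono) auto
  also have "ennreal (1 / C) * (ennreal C * (\<Sum>i\<le>m. emeasure M (E i))) = (\<Sum>i\<le>m. emeasure M (E i))"
    using C by (simp add: mult.assoc[symmetric] ennreal_mult[symmetric])
  finally show ?thesis using 1 by simp
qed

text \<open>The grid of level \<open>n\<close> has mesh \<open>1 / 2 ^ n\<close> and ends at
  \<open>2 ^ n\<close>, so mesh and horizon are refined together. The grids are nested, hence the
  bound \<open>1 / C\<close> survives the union over all levels.\<close>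

lemma AE_bessel_mart_dyadic_bounded:
  "AE \<omega> in M. \<exists>C. \<forall>n i. i \<le> 4 ^ n \<longrightarrow> bessel_mart mu (real i / 2 ^ n) \<omega> \<le> C"
proof -
  let ?N = "\<lambda>n i. bessel_mart mu (real i * (1 / 2 ^ n))"
  define S where "S C n = {\<omega> \<in> space M. \<exists>i\<le>4 ^ n. C \<le> ?N n i \<omega>}" for C :: real and n :: nat
  have [measurable]: "?N n j \<in> borel_measurable M" for n j by (intro borel_measurable_bessel_mart') auto
  have S [measurable]: "S C n \<in> sets M" for C n
  proof -
    have "{\<omega> \<in> space M. \<exists>i\<in>{..4 ^ n}. C \<le> ?N n i \<omega>} \<in> sets M" by measurable
    thus ?thesis by (simp add: S_def Bex_def atMost_def)
  qed
  have le: "emeasure M (\<Union>n. S C n) \<le> ennreal (1 / C)" if "C > 0" for C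
  proof -
    have "incseq (S C)"
    proof (rule incseq_SucI, safe)
      fix n \<omega> assume "\<omega> \<in> S C n"
      then obtain i where i: "\<omega> \<in> space M" "i \<le> 4 ^ n" "C \<le> ?N n i \<omega>" by (auto simp: S_def)
      \<comment> \<open>Index \<open>i\<close> of one grid is the time with index
        \<open>2 * i\<close> of the next.\<close>
      have "?N (Suc n) (2 * i) = ?N n i" by simp
      moreover have "2 * i \<le> 4 ^ Suc n" using i(2) by simp
      ultimately show "\<omega> \<in> S C (Suc n)" using i(1,3) unfolding S_def by (metis (mono_tags, lifting) mem_Collect_eq)
    qed
    hence "emeasure M (\<Union>n. S C n) = (SUP n. emeasure M (S C n))"
      by (intro SUP_emeasure_incseq[symmetric]) auto
    also have "\<dots> \<le> ennreal (1 / C)"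
      unfolding S_def using that by (intro SUP_least bessel_mart_maximal) auto
    finally show ?thesis .
  qed
  \<comment> \<open>\<open>T\<close> is the event that every positive integer level is reached on
    some grid. Using \<open>Suc C\<close> keeps the levels positive, as \<open>le\<close>
    requires.\<close>
  define T where "T = (\<Inter>C::nat. \<Union>n. S (real (Suc C)) n)"
  have T [measurable]: "T \<in> sets M" unfolding T_def by measurable
  have "emeasure M T \<le> ennreal (1 / real (Suc C))" for C
  proof -
    have "emeasure M T \<le> emeasure M (\<Union>n. S (real (Suc C)) n)"
      unfolding T_def by (intro emeasure_mono) auto
    also have "\<dots> \<le> ennreal (1 / real (Suc C))" by (rule le) simp
    finally show ?thesis .
  qed
  moreover have "(\<lambda>C. ennreal (1 / real (Suc C))) \<longlonglongrightarrow> ennreal 0"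
    using LIMSEQ_inverse_real_of_nat by (intro tendsto_ennrealI) (simp add: inverse_eq_divide)
  ultimately have "emeasure M T \<le> ennreal 0"
    by (intro tendsto_lowerbound[of _ "ennreal 0" sequentially "emeasure M T"]) auto
  hence "T \<in> null_sets M" by (auto intro!: null_setsI)
  hence "AE \<omega> in M. \<omega> \<notin> T" by (rule AE_not_in)
  thus ?thesis using AE_space
  proof eventually_elim
    case (elim \<omega>)
    then obtain C :: nat where C: "\<And>n. \<omega> \<notin> S (real (Suc C)) n" by (auto simp: T_def)
    show ?case
    proof (intro exI[of _ "real (Suc C)"] allI impI)
      fix n i :: nat assume "i \<le> 4 ^ n"
      thus "bessel_mart mu (real i / 2 ^ n) \<omega> \<le> real (Suc C)"
        using C[of n] elim(2) unfolding S_def by (force simp: not_le simp del: of_nat_Suc)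
    qed
  qed
qed

end

section \<open>Pathwise deduction of the strong law\<close>

lemma dyadic_approximation:
  fixes t :: real
  assumes "t \<ge> 0"
  obtains i :: "nat \<Rightarrow> nat" where "(\<lambda>n. real (i n) / 2 ^ n) \<longlonglongrightarrow> t" "eventually (\<lambda>n. i n \<le> 4 ^ n) sequentially"
proof
  define i where "i n = nat \<lfloor>2 ^ n * t\<rfloor>" for n :: nat
  have i: "real (i n) \<le> 2 ^ n * t" "2 ^ n * t - 1 \<le> real (i n)" for n
    using assms unfolding i_def by (auto simp: of_nat_nat)
  show "(\<lambda>n. real (i n) / 2 ^ n) \<longlonglongrightarrow> t"
  proof (rule tendsto_sandwich)
    have "t - (1/2) ^ n \<le> real (i n) / 2 ^ n" for n
    proof -
      have "t - (1/2) ^ n = (2 ^ n * t - 1) / 2 ^ n" by (simp add: diff_divide_distrib power_one_over)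
      also have "\<dots> \<le> real (i n) / 2 ^ n" using i by (intro divide_right_mono) auto
      finally show ?thesis .
    qed
    thus "\<forall>\<^sub>F n in sequentially. t - (1/2) ^ n \<le> real (i n) / 2 ^ n" by simp
    show "\<forall>\<^sub>F n in sequentially. real (i n) / 2 ^ n \<le> t"
      using i by (intro always_eventually) (auto simp: field_simps)
    have "(\<lambda>n. t - (1/2) ^ n) \<longlonglongrightarrow> t - 0" by (intro tendsto_intros LIMSEQ_power_zero) auto
    thus "(\<lambda>n. t - (1/2) ^ n) \<longlonglongrightarrow> t" by simp
  qed auto
  \<comment> \<open>Grid \<open>n\<close> ends at \<open>2 ^ n\<close>, so it reaches
    \<open>t\<close> as soon as \<open>n \<ge> m\<close>.\<close>
  obtain m where m: "t < 2 ^ m" using real_arch_pow[of 2 t] by auto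
  have "i n \<le> 4 ^ n" if "n \<ge> m" for n
  proof -
    have "t \<le> 2 ^ n" using m power_increasing[OF that, of "2::real"] by linarith
    hence "2 ^ n * t \<le> 2 ^ n * (2 ^ n :: real)" by (intro mult_left_mono) auto
    also have "\<dots> = 4 ^ n" by (simp add: power_mult_distrib[symmetric])
    finally have "real (i n) \<le> 4 ^ n" using i(1)[of n] by linarith
    thus ?thesis by simp
  qed
  thus "eventually (\<lambda>n. i n \<le> 4 ^ n) sequentially" by (auto simp: eventually_sequentially)
qed

text \<open>The numerator of the ratio is at least a constant times \<open>exp (mu' * x t)\<close>,
  by \<open>hyp01_ge_exp\<close> with \<open>q = mu / mu'\<close>, and the denominator is at most
  \<open>exp (lam * x t)\<close>. Taking logarithms gives the claim, an upper or a lower bound on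
  \<open>x t\<close> according to the sign of \<open>mu' - lam\<close>.\<close>

lemma drift_bound:
  assumes k: "k \<ge> 0" and mu: "mu' > 0" "mu > mu'" and lam: "lam \<ge> 0"
    and bound: "\<And>t. t \<ge> 0 \<Longrightarrow> exp (- ((mu\<^sup>2 - lam\<^sup>2) * t / 2)) * bessel_ratio k mu lam (x t) \<le> C"
    and x: "\<And>t. t \<ge> 0 \<Longrightarrow> x t \<ge> 0"
  shows "\<exists>D. \<forall>t\<ge>0. (mu' - lam) * x t \<le> (mu\<^sup>2 - lam\<^sup>2) / 2 * t + D"
proof -
  obtain c where c: "c > 0" "\<And>z. z \<ge> 0 \<Longrightarrow> hyp01 (k + 1/2) (z\<^sup>2 / 4) \<ge> c * exp (z / (mu / mu'))"
    using hyp01_ge_exp[of "k + 1/2" "mu / mu'"] k mu by auto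
  show ?thesis
  proof (intro exI allI impI)
    fix t :: real assume t: "t \<ge> 0"
    let ?e = "exp (- ((mu\<^sup>2 - lam\<^sup>2) * t / 2))"
    let ?y = "(mu' - lam) * x t - (mu\<^sup>2 - lam\<^sup>2) * t / 2"
    have p: "hyp01 (k + 1/2) ((x t * lam)\<^sup>2 / 4) > 0" by (rule hyp01_pos[OF k]) simp
    have "c * exp (mu' * x t) / exp (lam * x t) \<le> bessel_ratio k mu lam (x t)"
      unfolding bessel_ratio_def
    proof (rule frac_le)
      show "c * exp (mu' * x t) \<le> hyp01 (k + 1/2) ((x t * mu)\<^sup>2 / 4)"
        using c(2)[of "x t * mu"] x[OF t] mu by (simp add: mult.commute)
      show "hyp01 (k + 1/2) ((x t * lam)\<^sup>2 / 4) \<le> exp (lam * x t)"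
        using hyp01_le_exp[of "k + 1/2" "x t * lam"] k lam x[OF t] by (simp add: mult.commute)
    qed (use p less_imp_le[OF hyp01_pos[OF k]] in auto)
    hence "?e * (c * exp (mu' * x t) / exp (lam * x t)) \<le> ?e * bessel_ratio k mu lam (x t)"
      by (intro mult_left_mono) auto
    also have "\<dots> \<le> C" by (rule bound[OF t])
    also have "?e * (c * exp (mu' * x t) / exp (lam * x t)) = c * (?e * (exp (mu' * x t) / exp (lam * x t)))"
      by simp
    also have "?e * (exp (mu' * x t) / exp (lam * x t)) = exp ?y"
      unfolding exp_diff[symmetric] exp_add[symmetric] by (simp add: left_diff_distrib[of mu'])
    finally have y: "exp ?y \<le> C / c" using c by (simp add: field_simps)
    \<comment> \<open>\<open>C / c\<close> dominates an exponential and is therefore positive, so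
      \<open>ln\<close> has its genuine value.\<close>
    hence "?y \<le> ln (C / c)"
      using less_le_trans[OF exp_gt_zero y] by (simp add: ln_ge_iff)
    thus "(mu' - lam) * x t \<le> (mu\<^sup>2 - lam\<^sup>2) / 2 * t + ln (C / c)" by simp
  qed
qed

lemma eventually_linear_less:
  fixes a b D :: real
  assumes "a < b"
  shows "eventually (\<lambda>t. a * t + D < b * t) at_top"
  using eventually_gt_at_top[of "D / (b - a)"]
  by eventually_elim (use assms in \<open>simp add: field_simps\<close>)

text \<open>With \<open>mu' = mu\<close> the bound would give the slope
  \<open>(mu + lam) / 2\<close>, which lies on the same side of \<open>lam\<close> as
  \<open>mu\<close> and tends to \<open>lam\<close>. Rational \<open>mu\<close> suffice by density,
  and there are only countably many of them.\<close>

lemma tendsto_drift: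
  assumes k: "k \<ge> 0" and lam: "lam > 0"
    and bound: "\<And>mu. mu \<in> \<rat> \<Longrightarrow> mu > 0 \<Longrightarrow>
      \<exists>C. \<forall>t\<ge>0. exp (- ((mu\<^sup>2 - lam\<^sup>2) * t / 2)) * bessel_ratio k mu lam (x t) \<le> C"
    and x: "\<And>t. t \<ge> 0 \<Longrightarrow> x t \<ge> 0"
  shows "((\<lambda>t. x t / t) \<longlongrightarrow> lam) at_top"
proof -
  have bd: "\<exists>D. \<forall>t\<ge>0. (mu' - lam) * x t \<le> (mu\<^sup>2 - lam\<^sup>2) / 2 * t + D"
    if mu: "mu \<in> \<rat>" "mu' > 0" "mu > mu'" for mu mu'
  proof -
    obtain C where "\<And>t. t \<ge> 0 \<Longrightarrow> exp (- ((mu\<^sup>2 - lam\<^sup>2) * t / 2)) * bessel_ratio k mu lam (x t) \<le> C"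
      using bound[OF mu(1)] mu(2,3) by (meson less_trans)
    from drift_bound[OF k mu(2,3) less_imp_le[OF lam] this x] show ?thesis .
  qed
  have upper: "eventually (\<lambda>t. x t / t < b) at_top" if b: "b > lam" for b
  proof -
    obtain mu where mu: "mu \<in> \<rat>" "lam < mu" "mu < b" using Rats_dense_in_real[OF b] by auto
    have "(mu - lam) * (mu + lam) < (mu - lam) * (2 * b)"
      using mu b by (intro mult_strict_left_mono) auto
    \<comment> \<open>This is \<open>(mu + lam) / 2 < b\<close> rewritten. Being strict, it leaves
      room for some \<open>mu' < mu\<close> whose slope is still below \<open>b\<close>.\<close>
    hence "lam + (mu\<^sup>2 - lam\<^sup>2) / (2 * b) < mu"
      using b lam by (simp add: field_simps power2_eq_square)
    then obtain mu' where mu': "lam + (mu\<^sup>2 - lam\<^sup>2) / (2 * b) < mu'" "mu' < mu" using dense by blast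
    have "mu\<^sup>2 > lam\<^sup>2" using mu lam by (intro power_strict_mono) auto
    hence "(mu\<^sup>2 - lam\<^sup>2) / (2 * b) > 0" using b lam by (intro divide_pos_pos) auto
    hence l: "mu' > lam" using mu'(1) by linarith
    have *: "(mu\<^sup>2 - lam\<^sup>2) / 2 < (mu' - lam) * b"
      using mu'(1) b lam by (simp add: field_simps)
    obtain D where D: "\<And>t. t \<ge> 0 \<Longrightarrow> (mu' - lam) * x t \<le> (mu\<^sup>2 - lam\<^sup>2) / 2 * t + D"
      using bd[OF mu(1) _ mu'(2)] l lam by auto
    show ?thesis using eventually_linear_less[OF *, of D] eventually_gt_at_top[of 0]
    proof eventually_elim
      case (elim t)
      hence "(mu' - lam) * x t < (mu' - lam) * (b * t)" using D[of t] by simp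
      hence "x t < b * t" using l by simp
      thus ?case using elim by (simp add: field_simps)
    qed
  qed
  have lower: "eventually (\<lambda>t. b' < x t / t) at_top" if b': "b' < lam" for b'
  proof -
    \<comment> \<open>The maximum with \<open>lam / 2\<close> makes the threshold positive, so that
      division by \<open>b\<close> is harmless and \<open>mu > b\<close> is positive.\<close>
    define b where "b = max b' (lam / 2)"
    have b: "b < lam" "b > 0" "b' \<le> b" using b' lam by (auto simp: b_def)
    obtain mu where mu: "mu \<in> \<rat>" "b < mu" "mu < lam" using Rats_dense_in_real[OF b(1)] by auto
    have "(lam - mu) * (2 * b) < (lam - mu) * (lam + mu)"
      using mu b by (intro mult_strict_left_mono) auto
    hence "lam - (lam\<^sup>2 - mu\<^sup>2) / (2 * b) < mu"
      using b lam by (simp add: field_simps power2_eq_square)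
    \<comment> \<open>The 0 ensures \<open>mu' > 0\<close>, which \<open>drift_bound\<close>
      demands.\<close>
    hence "max 0 (lam - (lam\<^sup>2 - mu\<^sup>2) / (2 * b)) < mu" using mu b by simp
    then obtain mu' where mu': "max 0 (lam - (lam\<^sup>2 - mu\<^sup>2) / (2 * b)) < mu'" "mu' < mu" using dense by blast
    have *: "(mu\<^sup>2 - lam\<^sup>2) / 2 < (mu' - lam) * b"
      using mu'(1) b lam by (simp add: field_simps)
    obtain D where D: "\<And>t. t \<ge> 0 \<Longrightarrow> (mu' - lam) * x t \<le> (mu\<^sup>2 - lam\<^sup>2) / 2 * t + D"
      using bd[OF mu(1) _ mu'(2)] mu'(1) by auto
    show ?thesis
      using eventually_linear_less[OF *, of D] eventually_gt_at_top[of 0]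
    proof eventually_elim
      case (elim t)
      hence "(mu' - lam) * x t < (mu' - lam) * (b * t)" using D[of t] by simp
      \<comment> \<open>Here \<open>mu' - lam\<close> is negative, so cancelling it reverses the
        inequality.\<close>
      hence "b * t < x t" using mu mu' by (simp add: mult_less_cancel_left)
      hence "b < x t / t" using elim by (simp add: field_simps)
      thus ?case using b(3) by linarith
    qed
  qed
  from lower upper show ?thesis by (rule order_tendstoI)
qed

context bessel_process_0
begin

text \<open>One null set serves all rational \<open>mu\<close>. Off it, path continuity carries the
  bounds from dyadic times to all times.\<close>

lemma AE_tendsto_drift:
  assumes lam: "lam > 0"
    and cont: "\<And>\<omega>. \<omega> \<in> space M \<Longrightarrow> continuous_on {0..} (\<lambda>t. X t \<omega>)"
  shows "AE \<omega> in M. ((\<lambda>t. X t \<omega> / t) \<longlongrightarrow> lam) at_top"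
proof -
  have "AE \<omega> in M. \<forall>mu\<in>\<rat>. \<exists>C. \<forall>n i. i \<le> 4 ^ n \<longrightarrow> bessel_mart mu (real i / 2 ^ n) \<omega> \<le> C"
    by (intro AE_ball_countable' AE_bessel_mart_dyadic_bounded countable_rat)
  thus ?thesis using AE_space
  proof eventually_elim
    case (elim \<omega>)
    show ?case
    proof (rule tendsto_drift[OF multiplicity_nonneg lam])
      fix mu :: real assume "mu \<in> \<rat>"
      then obtain C where C: "\<And>n i. i \<le> 4 ^ n \<Longrightarrow> bessel_mart mu (real i / 2 ^ n) \<omega> \<le> C"
        using elim(1) by blast
      have "bessel_mart mu t \<omega> \<le> C" if t: "t \<ge> 0" for t
      proof -
        obtain i :: "nat \<Rightarrow> nat" where i: "(\<lambda>n. real (i n) / 2 ^ n) \<longlonglongrightarrow> t" "eventually (\<lambda>n. i n \<le> 4 ^ n) sequentially"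
          using dyadic_approximation[OF t] .
        have "continuous_on {0..} (\<lambda>t. bessel_ratio k mu lam (X t \<omega>))"
          by (rule continuous_on_compose2[OF continuous_on_bessel_ratio[OF multiplicity_nonneg] cont[OF elim(2)]]) simp
        hence "continuous_on {0..} (\<lambda>t. bessel_mart mu t \<omega>)"
          unfolding bessel_mart_def by (intro continuous_intros) auto
        hence "(\<lambda>n. bessel_mart mu (real (i n) / 2 ^ n) \<omega>) \<longlonglongrightarrow> bessel_mart mu t \<omega>"
          by (rule continuous_on_tendsto_compose[OF _ i(1)]) (use t in auto)
        moreover have "eventually (\<lambda>n. bessel_mart mu (real (i n) / 2 ^ n) \<omega> \<le> C) sequentially"
          using i(2) by eventually_elim (rule C)
        ultimately show ?thesis by (intro tendsto_upperbound[of _ _ sequentially]) auto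
      qed
      thus "\<exists>C. \<forall>t\<ge>0. exp (- ((mu\<^sup>2 - lam\<^sup>2) * t / 2)) * bessel_ratio k mu lam (X t \<omega>) \<le> C"
        unfolding bessel_mart_def by blast
    qed (use nonneg_X elim(2) in auto)
  qed
qed

end

subsection \<open>The central limit theorem\<close>

abbreviation gamma_weight :: "real \<Rightarrow> real \<Rightarrow> real" where
  "gamma_weight a z \<equiv> indicator {0<..} z * z powr (a - 1) * exp (-z)"

lemma has_bochner_integral_gamma_weight:
  assumes "a > 0"
  shows "has_bochner_integral lborel (\<lambda>z. gamma_weight a z * z ^ n) (Gamma a * pochhammer a n)"
proof (rule has_bochner_integral_nn_integral)
  show "AE z in lborel. 0 \<le> gamma_weight a z * z ^ n" by (auto simp: indicator_def)
  show "0 \<le> Gamma a * pochhammer a n"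
    using pochhammer_pos[OF assms, of n] Gamma_real_pos[OF assms] by simp
qed (use nn_integral_gamma_powr[OF assms] in auto)

text \<open>Translates the binomial series of \<open>(1 - x) powr (- a)\<close> into the rising
  factorials that occur as gamma moments.\<close>

lemma gbinomial_minus_mult_power:
  fixes a x :: "'a :: field_char_0"
  shows "((- a) gchoose m) * (- x) ^ m = pochhammer a m * (x ^ m / fact m)"
proof -
  have "((- a) gchoose m) * (- x) ^ m = ((-1) ^ m * (-1) ^ m) * (pochhammer a m * (x ^ m / fact m))"
    by (simp add: gbinomial_pochhammer power_minus[of x])
  also have "(-1) ^ m * (-1) ^ m = (1 :: 'a)" by (simp flip: power_mult_distrib)
  finally show ?thesis by simp
qed

text \<open>Integrating the exponential series term by term yields the binomial series of
  \<open>(1 - s) powr (- a)\<close>. Its absolute convergence for \<open>norm s < 1\<close>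
  justifies exchanging sum and integral.\<close>

lemma gamma_weight_exp:
  fixes s :: complex
  assumes a: "a > 0" and s: "norm s < 1"
  shows "integrable lborel (\<lambda>z. of_real (gamma_weight a z) * exp (s * of_real z))" (is ?th1)
    and "(\<integral>z. of_real (gamma_weight a z) * exp (s * of_real z) \<partial>lborel) =
      of_real (Gamma a) * (1 - s) powr (- of_real a)" (is ?th2)
proof -
  define f where "f m z = complex_of_real (gamma_weight a z * z ^ m) * (s ^ m / fact m)" for m z
  have fsums: "(\<lambda>m. f m z) sums (of_real (gamma_weight a z) * exp (s * of_real z))" for z
  proof -
    have "(\<lambda>m. of_real (gamma_weight a z) * ((s * of_real z) ^ m /\<^sub>R fact m)) sums (of_real (gamma_weight a z) * exp (s * of_real z))"
      by (intro sums_mult exp_converges)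
    thus ?thesis
      by (simp add: f_def scaleR_conv_of_real power_mult_distrib divide_inverse mult_ac)
  qed
  have hb: "has_bochner_integral lborel (f m) (of_real (Gamma a * pochhammer a m) * (s ^ m / fact m))" for m
    unfolding f_def [abs_def] using has_bochner_integral_gamma_weight[OF a, of m]
    by (intro has_bochner_integral_mult_left has_bochner_integral_of_real) auto
  have hbn: "has_bochner_integral lborel (\<lambda>z. norm (f m z)) ((Gamma a * pochhammer a m) * (norm s ^ m / fact m))" for m
  proof -
    have "norm (f m z) = (gamma_weight a z * z ^ m) * (norm s ^ m / fact m)" for z
      by (auto simp: f_def norm_mult norm_divide norm_power indicator_def)
    thus ?thesis using has_bochner_integral_gamma_weight[OF a, of m]
      by (simp only: ) (intro has_bochner_integral_mult_left, auto)
  qed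
  have int: "integrable lborel (f m)" for m using hb by (rule integrable.intros)
  have summ: "AE z in lborel. summable (\<lambda>m. norm (f m z))"
  proof (rule AE_I2)
    fix z
    have "summable (\<lambda>m. \<bar>gamma_weight a z\<bar> * (inverse (fact m) * (norm s * \<bar>z\<bar>) ^ m))"
      by (intro summable_mult summable_exp)
    thus "summable (\<lambda>m. norm (f m z))"
      by (simp add: f_def norm_mult norm_divide norm_power norm_inverse power_mult_distrib power_abs abs_mult divide_inverse mult_ac)
  qed
  have summ2: "summable (\<lambda>m. \<integral>z. norm (f m z) \<partial>lborel)"
  proof -
    have "summable (\<lambda>m. Gamma a * (((- a) gchoose m) * (- norm s) ^ m))"
      using gen_binomial_real[of "- norm s" "- a"] s by (intro summable_mult) (auto simp: sums_iff)
    moreover have "Gamma a * (((- a) gchoose m) * (- norm s) ^ m) = (\<integral>z. norm (f m z) \<partial>lborel)" for m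
      unfolding gbinomial_minus_mult_power has_bochner_integral_integral_eq[OF hbn[of m]] by simp
    ultimately show ?thesis by simp
  qed
  have *: "(\<Sum>m. f m z) = of_real (gamma_weight a z) * exp (s * of_real z)" for z
    using fsums by (simp add: sums_iff)
  show ?th1 using integrable_suminf[OF int summ summ2] unfolding * .
  have "(\<lambda>m. integral\<^sup>L lborel (f m)) sums (\<integral>z. of_real (gamma_weight a z) * exp (s * of_real z) \<partial>lborel)"
    using sums_integral[OF int summ summ2] unfolding * .
  moreover have "(\<lambda>m. integral\<^sup>L lborel (f m)) sums (of_real (Gamma a) * (1 - s) powr (- of_real a))"
  proof -
    have "(\<lambda>m. of_real (Gamma a) * (((- of_real a) gchoose m) * (- s) ^ m)) sums (of_real (Gamma a) * (1 + - s) powr (- of_real a))"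
      using s by (intro sums_mult gen_binomial_complex) simp
    moreover have "of_real (Gamma a) * (((- of_real a) gchoose m) * (- s) ^ m) = integral\<^sup>L lborel (f m)" for m
      unfolding gbinomial_minus_mult_power has_bochner_integral_integral_eq[OF hb[of m]]
      by (simp add: pochhammer_of_real)
    ultimately show ?thesis by simp
  qed
  ultimately show ?th2 by (rule sums_unique2)
qed

text \<open>The \<open>n\<close>-th term of the \<open>hyp01\<close> series shifts the gamma
  parameter to \<open>a + real n\<close> and so contributes a factor \<open>1 / (1 - s) ^ n\<close>,
  where \<open>s = \<i> * \<theta>\<close>. The rising factorial cancels against
  \<open>Gamma (a + real n)\<close>, which leaves the exponential series in
  \<open>B / (1 - s)\<close>.\<close>

lemma gamma_weight_hyp01_char:
  fixes \<theta> :: real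
  assumes a: "a > 0" and B: "B \<ge> 0" and \<theta>: "\<bar>\<theta>\<bar> < 1"
  shows "(\<integral>z. of_real (gamma_weight a z * hyp01 a (B * z)) * exp (\<i> * of_real \<theta> * of_real z) \<partial>lborel) =
    of_real (Gamma a) * (1 - \<i> * of_real \<theta>) powr (- of_real a) * exp (of_real B / (1 - \<i> * of_real \<theta>))"
proof -
  let ?s = "\<i> * complex_of_real \<theta>"
  have s: "norm ?s < 1" using \<theta> by (simp add: norm_mult)
  have s1: "1 - ?s \<noteq> 0" using s by (metis eq_iff_diff_eq_0 less_irrefl norm_one)
  have G: "Gamma a > 0" using a by simp
  have pos: "pochhammer a n > 0" for n using pochhammer_pos[OF a] .
  define c where "c n = B ^ n / (fact n * pochhammer a n)" for n
  have c: "c n \<ge> 0" for n using B pos[of n] by (simp add: c_def)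
  define f where "f n z = complex_of_real (gamma_weight a z * (c n * z ^ n)) * exp (?s * of_real z)" for n z
  have gw: "gamma_weight a z * z ^ n = gamma_weight (a + real n) z" for n z
    by (auto simp: indicator_def powr_add powr_diff powr_realpow)
  have f_eq: "f n = (\<lambda>z. of_real (c n) * (of_real (gamma_weight (a + real n) z) * exp (?s * of_real z)))" for n
    unfolding gw[symmetric] by (simp add: f_def fun_eq_iff)
  have an: "a + real n > 0" for n using a by simp
  have int: "integrable lborel (f n)" for n
    unfolding f_eq by (intro integrable_mult_right gamma_weight_exp an s)
  have hs: "(\<lambda>n. c n * z ^ n) sums hyp01 a (B * z)" "summable (\<lambda>n. norm (c n * z ^ n))" for z
  proof -
    have eq: "c n * z ^ n = (B * z) ^ n / (fact n * pochhammer a n)" for n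
      by (simp add: c_def power_mult_distrib)
    show "(\<lambda>n. c n * z ^ n) sums hyp01 a (B * z)" "summable (\<lambda>n. norm (c n * z ^ n))"
      unfolding eq hyp01_def by (rule summable_sums[OF summable_hyp01[OF a]], rule summable_norm_hyp01[OF a])
  qed
  have fsums: "(\<lambda>n. f n z) sums (of_real (gamma_weight a z * hyp01 a (B * z)) * exp (?s * of_real z))" for z
    unfolding f_def by (intro sums_mult2 sums_of_real sums_mult hs)
  have summ: "AE z in lborel. summable (\<lambda>n. norm (f n z))"
  proof (rule AE_I2)
    fix z
    have "summable (\<lambda>n. \<bar>gamma_weight a z\<bar> * norm (exp (?s * of_real z)) * norm (c n * z ^ n))"
      by (intro summable_mult hs)
    thus "summable (\<lambda>n. norm (f n z))" by (simp add: f_def norm_mult abs_mult norm_power power_abs mult_ac)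
  qed
  \<comment> \<open>By \<open>gw\<close>, the \<open>n\<close>-th moment for \<open>a\<close> and
    the total mass for \<open>a + real n\<close> integrate the same function.\<close>
  have Gn: "Gamma (a + real n) = Gamma a * pochhammer a n" for n
    using has_bochner_integral_integral_eq[OF has_bochner_integral_gamma_weight[OF a, of n]]
      has_bochner_integral_integral_eq[OF has_bochner_integral_gamma_weight[OF an, of n 0]]
    by (simp add: gw)
  have cG: "c n * Gamma (a + real n) = Gamma a * (B ^ n / fact n)" for n
    using pos[of n] by (simp add: c_def Gn)
  have summ2: "summable (\<lambda>n. \<integral>z. norm (f n z) \<partial>lborel)"
  proof -
    have "(\<integral>z. norm (f n z) \<partial>lborel) = Gamma a * (inverse (fact n) * B ^ n)" for n
    proof -
      have "norm (f n z) = c n * (gamma_weight (a + real n) z * z ^ 0)" for z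
        using c[of n] by (auto simp: f_eq norm_mult indicator_def)
      hence "(\<integral>z. norm (f n z) \<partial>lborel) = c n * Gamma (a + real n)"
        using has_bochner_integral_integral_eq[OF has_bochner_integral_gamma_weight[OF an, of n 0]] by simp
      thus ?thesis unfolding cG by (simp add: divide_inverse mult.commute)
    qed
    thus ?thesis by (simp only:) (intro summable_mult summable_exp)
  qed
  have *: "(\<Sum>n. f n z) = of_real (gamma_weight a z * hyp01 a (B * z)) * exp (?s * of_real z)" for z
    using fsums[of z] by (simp add: sums_iff)
  have "(\<lambda>n. integral\<^sup>L lborel (f n)) sums (\<integral>z. of_real (gamma_weight a z * hyp01 a (B * z)) * exp (?s * of_real z) \<partial>lborel)"
    using sums_integral[OF int summ summ2] unfolding * .
  moreover have "(\<lambda>n. integral\<^sup>L lborel (f n)) sums (of_real (Gamma a) * (1 - ?s) powr (- of_real a) * exp (of_real B / (1 - ?s)))"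
  proof -
    have "integral\<^sup>L lborel (f n) = of_real (Gamma a) * (1 - ?s) powr (- of_real a) * ((of_real B / (1 - ?s)) ^ n /\<^sub>R fact n)" for n
    proof -
      have "integral\<^sup>L lborel (f n) = of_real (c n) * (of_real (Gamma (a + real n)) * (1 - ?s) powr (- of_real (a + real n)))"
        unfolding f_eq using gamma_weight_exp(2)[OF an s] by simp
      also have "\<dots> = of_real (c n * Gamma (a + real n)) * (1 - ?s) powr (- of_real (a + real n))"
        by simp
      also have "(1 - ?s) powr (- of_real (a + real n)) = (1 - ?s) powr (- of_real a) * (1 / (1 - ?s)) ^ n"
      proof -
        have "(1 - ?s) powr (- of_real a - of_nat n) = (1 - ?s) powr (- of_real a) / (1 - ?s) powr (of_nat n)"
          by (rule powr_diff)
        also have "(1 - ?s) powr (of_nat n) = (1 - ?s) ^ n" using s1 by (simp add: powr_nat')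
        finally show ?thesis by (simp add: power_one_over)
      qed
      finally show ?thesis unfolding cG
        by (simp add: scaleR_conv_of_real power_divide divide_inverse power_mult_distrib mult_ac)
    qed
    thus ?thesis by (simp only:) (intro sums_mult exp_converges)
  qed
  ultimately show ?thesis by (rule sums_unique2)
qed

lemma isCont_cdf_std_normal: "isCont (cdf std_normal_distribution) x"
proof -
  interpret N: real_distribution std_normal_distribution by (rule real_dist_normal_dist)
  have "emeasure std_normal_distribution {x} = 0"
    using AE_lborel_singleton[of x]
    by (subst emeasure_density, simp, simp, subst nn_integral_0_iff_AE) (auto simp: indicator_def)
  thus ?thesis by (simp add: N.isCont_cdf measure_def)
qed

context bessel_process_0
begin

text \<open>Up to scaling this is a noncentral chi-squared law, that is, a Poisson mixture of Gamma laws,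
  which is why its characteristic function is explicit.\<close>

lemma distr_square:
  fixes t :: real
  assumes t: "t > 0"
  defines "a \<equiv> k + 1 / 2" and "B \<equiv> lam\<^sup>2 * t / 2"
  shows "distr M borel (\<lambda>\<omega>. (X t \<omega>)\<^sup>2 / (2 * t)) =
    density lborel (\<lambda>z. ennreal (exp (- B) / Gamma a * (gamma_weight a z * hyp01 a (B * z))))"
proof (rule measure_eqI)
  have a: "a > 0" using multiplicity_nonneg by (simp add: a_def)
  note [measurable] = borel_measurable_hyp01[OF a] measurable_X[OF less_imp_le[OF t]]
  fix A assume "A \<in> sets (distr M borel (\<lambda>\<omega>. (X t \<omega>)\<^sup>2 / (2 * t)))"
  hence [measurable]: "A \<in> sets borel" by simp
  have "emeasure (distr M borel (\<lambda>\<omega>. (X t \<omega>)\<^sup>2 / (2 * t))) A = (\<integral>\<^sup>+z. indicator A z \<partial>distr M borel (\<lambda>\<omega>. (X t \<omega>)\<^sup>2 / (2 * t)))"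
    by simp
  also have "\<dots> = (\<integral>\<^sup>+\<omega>. indicator A ((X t \<omega>)\<^sup>2 / (2 * t)) \<partial>M)"
    by (rule nn_integral_distr) measurable
  also have "\<dots> = (\<integral>\<^sup>+y. ennreal (bessel_density lam k t 0 y) * indicator A (y\<^sup>2 / (2 * t)) \<partial>lborel)"
    by (rule nn_integral_marginal[OF t]) measurable
  also have "\<dots> = (\<integral>\<^sup>+z. ennreal (exp (- B) / Gamma a * (gamma_weight a z * hyp01 a (B * z))) * indicator A z \<partial>lborel)"
    using bessel_density_substitution[OF multiplicity_nonneg t, of "indicator A" lam 0]
    by (simp add: a_def[symmetric] B_def[symmetric])
  also have "\<dots> = emeasure (density lborel (\<lambda>z. ennreal (exp (- B) / Gamma a * (gamma_weight a z * hyp01 a (B * z))))) A"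
    by (rule emeasure_density[symmetric]) auto
  finally show "emeasure (distr M borel (\<lambda>\<omega>. (X t \<omega>)\<^sup>2 / (2 * t))) A = \<dots>" .
qed simp

text \<open>The range of \<open>\<theta>\<close> is that of the binomial series behind it. It is
  wide enough for the limit, in which the arguments tend to 0.\<close>

lemma char_square:
  assumes t: "t > 0" and \<theta>: "\<bar>\<theta>\<bar> < 1"
  shows "char (distr M borel (\<lambda>\<omega>. (X t \<omega>)\<^sup>2 / (2 * t))) \<theta> =
    (1 - \<i> * of_real \<theta>) powr (- of_real (k + 1 / 2)) *
      exp (of_real (lam\<^sup>2 * t / 2) / (1 - \<i> * of_real \<theta>) - of_real (lam\<^sup>2 * t / 2))"
proof -
  define a B where "a = k + 1 / 2" and "B = lam\<^sup>2 * t / 2"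
  have a: "a > 0" using multiplicity_nonneg by (simp add: a_def)
  have B: "B \<ge> 0" using t by (simp add: B_def)
  have G: "Gamma a > 0" using a by simp
  note [measurable] = borel_measurable_hyp01[OF a]
  have nn: "gamma_weight a z * hyp01 a (B * z) \<ge> 0" for z
    using hyp01_ge_1[OF a, of "B * z"] B by (cases "z > 0") auto
  have "char (distr M borel (\<lambda>\<omega>. (X t \<omega>)\<^sup>2 / (2 * t))) \<theta> =
    (\<integral>z. iexp (\<theta> * z) \<partial>density lborel (\<lambda>z. ennreal (exp (- B) / Gamma a * (gamma_weight a z * hyp01 a (B * z)))))"
    unfolding char_def distr_square[OF t] a_def[symmetric] B_def[symmetric] ..
  also have "\<dots> = (\<integral>z. (exp (- B) / Gamma a * (gamma_weight a z * hyp01 a (B * z))) *\<^sub>R iexp (\<theta> * z) \<partial>lborel)"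
    using nn G by (intro integral_density) auto
  also have "\<dots> = (\<integral>z. of_real (exp (- B) / Gamma a) *
      (of_real (gamma_weight a z * hyp01 a (B * z)) * exp (\<i> * of_real \<theta> * of_real z)) \<partial>lborel)"
    by (intro Bochner_Integration.integral_cong refl) (simp add: scaleR_conv_of_real mult_ac)
  also have "\<dots> = of_real (exp (- B) / Gamma a) * (of_real (Gamma a) * (1 - \<i> * of_real \<theta>) powr (- of_real a) * exp (of_real B / (1 - \<i> * of_real \<theta>)))"
    by (simp only: integral_mult_right_zero gamma_weight_hyp01_char[OF a B \<theta>])
  also have "\<dots> = (1 - \<i> * of_real \<theta>) powr (- of_real a) * exp (of_real B / (1 - \<i> * of_real \<theta>) - of_real B)"
    using G by (simp add: exp_diff exp_minus exp_of_real[symmetric] divide_inverse mult_ac)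
  finally show ?thesis by (simp add: a_def B_def)
qed

section \<open>Levy continuity and transfer from the square to the process\<close>

definition square_fluct :: "real \<Rightarrow> 'a \<Rightarrow> real" where
  "square_fluct t \<omega> = ((X t \<omega>)\<^sup>2 / (2 * t) - lam\<^sup>2 * t / 2) / (lam * sqrt t)"

lemma borel_measurable_square_fluct [measurable]: "t \<ge> 0 \<Longrightarrow> square_fluct t \<in> borel_measurable M"
  unfolding square_fluct_def [abs_def] using measurable_X[of t] by simp

text \<open>With \<open>r = lam * sqrt t\<close>, so that \<open>u = \<theta> * r\<close>, the
  centring turns the exponent into \<open>r\<^sup>2 / 2\<close> times
  \<open>1 / (1 - \<i> * \<theta>) - 1 - \<i> * \<theta>\<close>. The last expression equals
  \<open>- \<theta>\<^sup>2 / (1 - \<i> * \<theta>)\<close>.\<close>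

lemma char_square_fluct:
  assumes t: "t > 0" and lam: "lam > 0" and u: "\<bar>u\<bar> < lam * sqrt t"
  defines "\<theta> \<equiv> u / (lam * sqrt t)"
  shows "char (distr M borel (square_fluct t)) u =
    (1 - \<i> * of_real \<theta>) powr (- of_real (k + 1 / 2)) * exp (- (of_real (u\<^sup>2 / 2) / (1 - \<i> * of_real \<theta>)))"
proof -
  define r where "r = lam * sqrt t"
  have r: "r > 0" "lam\<^sup>2 * t / 2 = r\<^sup>2 / 2" "\<theta> = u / r" "u = \<theta> * r"
    using t lam by (auto simp: r_def \<theta>_def power_mult_distrib)
  have "\<bar>\<theta>\<bar> = \<bar>u\<bar> / r" using r(1) by (simp add: r(3))
  hence \<theta>: "\<bar>\<theta>\<bar> < 1" using u r(1) by (simp add: r_def)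
  have z: "1 - \<i> * complex_of_real \<theta> \<noteq> 0" by (simp add: complex_eq_iff)
  have [measurable]: "X t \<in> borel_measurable M" using t by (intro measurable_X) simp
  let ?Z = "\<lambda>\<omega>. (X t \<omega>)\<^sup>2 / (2 * t)"
  have "char (distr M borel (square_fluct t)) u = (\<integral>\<omega>. iexp (u * square_fluct t \<omega>) \<partial>M)"
    unfolding char_def using t by (subst integral_distr) auto
  also have "\<dots> = (\<integral>\<omega>. exp (- (\<i> * of_real (\<theta> * r\<^sup>2 / 2))) * iexp (\<theta> * ?Z \<omega>) \<partial>M)"
  proof (intro Bochner_Integration.integral_cong refl)
    fix \<omega>
    have "u * square_fluct t \<omega> = - (\<theta> * r\<^sup>2 / 2) + \<theta> * ?Z \<omega>"
    proof -
      have "\<theta> * r * ((?Z \<omega> - r\<^sup>2 / 2) / r) = \<theta> * (?Z \<omega> - r\<^sup>2 / 2)" using r(1) by simp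
      thus ?thesis unfolding r(4) square_fluct_def r_def[symmetric] r(2) by (simp add: right_diff_distrib)
    qed
    thus "iexp (u * square_fluct t \<omega>) = exp (- (\<i> * of_real (\<theta> * r\<^sup>2 / 2))) * iexp (\<theta> * ?Z \<omega>)"
      by (simp only: exp_add[symmetric]) (simp add: algebra_simps)
  qed
  also have "\<dots> = exp (- (\<i> * of_real (\<theta> * r\<^sup>2 / 2))) * (\<integral>\<omega>. iexp (\<theta> * ?Z \<omega>) \<partial>M)"
    by (rule integral_mult_right_zero)
  also have "(\<integral>\<omega>. iexp (\<theta> * ?Z \<omega>) \<partial>M) = char (distr M borel ?Z) \<theta>"
    unfolding char_def by (rule integral_distr[symmetric]) auto
  also have "exp (- (\<i> * of_real (\<theta> * r\<^sup>2 / 2))) * char (distr M borel ?Z) \<theta> =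
     (1 - \<i> * of_real \<theta>) powr (- of_real (k + 1 / 2)) *
     exp (- (\<i> * of_real (\<theta> * r\<^sup>2 / 2)) + (of_real (r\<^sup>2 / 2) / (1 - \<i> * of_real \<theta>) - of_real (r\<^sup>2 / 2)))"
    unfolding char_square[OF t \<theta>] r(2) exp_add by (simp only: mult_ac)
  also have "- (\<i> * of_real (\<theta> * r\<^sup>2 / 2)) + (of_real (r\<^sup>2 / 2) / (1 - \<i> * of_real \<theta>) - of_real (r\<^sup>2 / 2)) =
     - (of_real (u\<^sup>2 / 2) / (1 - \<i> * of_real \<theta>))"
  proof -
    have "\<i> * (\<i> * w) = - w" for w by (simp flip: mult.assoc)
    thus ?thesis using z unfolding r(4)
      by (simp add: field_simps power2_eq_square)
  qed
  finally show ?thesis .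
qed

text \<open>For fixed \<open>u\<close> the parameter \<open>\<theta>\<close> tends to 0, hence the
  characteristic function tends to \<open>exp (- u\<^sup>2 / 2)\<close>. Levy's theorem is applied
  along an arbitrary sequence of times tending to infinity.\<close>

lemma tendsto_cdf_square_fluct:
  assumes lam: "lam > 0"
  shows "((\<lambda>t. cdf (distr M borel (square_fluct t)) x) \<longlongrightarrow> cdf std_normal_distribution x) at_top"
proof (rule tendsto_at_topI_sequentially)
  interpret N: real_distribution std_normal_distribution by (rule real_dist_normal_dist)
  fix \<tau> :: "nat \<Rightarrow> real" assume \<tau>: "filterlim \<tau> at_top sequentially"
  \<comment> \<open>Levy's theorem requires a probability law at every index, so early times are
    raised to 1. From some index on nothing changes.\<close>
  define \<sigma> where "\<sigma> n = max 1 (\<tau> n)" for n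
  have eq: "eventually (\<lambda>n. \<sigma> n = \<tau> n) sequentially"
    using filterlim_at_top[THEN iffD1, OF \<tau>, rule_format, of 1] by eventually_elim (simp add: \<sigma>_def)
  have \<sigma>: "filterlim \<sigma> at_top sequentially"
    by (rule filterlim_at_top_mono[OF \<tau>]) (auto simp: \<sigma>_def)
  have \<sigma>1: "\<sigma> n \<ge> 1" for n by (simp add: \<sigma>_def)
  have lims: "filterlim (\<lambda>n. lam * sqrt (\<sigma> n)) at_top sequentially"
    by (intro filterlim_tendsto_pos_mult_at_top[OF tendsto_const lam] filterlim_compose[OF sqrt_at_top \<sigma>])
  have "weak_conv_m (\<lambda>n. distr M borel (square_fluct (\<sigma> n))) std_normal_distribution"
  proof (rule levy_continuity)
    show "real_distribution (distr M borel (square_fluct (\<sigma> n)))" for n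
      using order_trans[OF zero_le_one \<sigma>1[of n]] by (intro real_distribution_distr) measurable
    show "real_distribution std_normal_distribution" by (rule real_dist_normal_dist)
    fix u :: real
    define \<theta> where "\<theta> n = u / (lam * sqrt (\<sigma> n))" for n
    have \<theta>0: "\<theta> \<longlonglongrightarrow> 0" unfolding \<theta>_def [abs_def]
      by (rule real_tendsto_divide_at_top[OF tendsto_const lims])
    \<comment> \<open>The explicit formula is available only once
      \<open>lam * sqrt (\<sigma> n)\<close> exceeds the absolute value of \<open>u\<close>.\<close>
    have ev: "eventually (\<lambda>n. (1 - \<i> * of_real (\<theta> n)) powr (- of_real (k + 1 / 2)) *
        exp (- (of_real (u\<^sup>2 / 2) / (1 - \<i> * of_real (\<theta> n)))) = char (distr M borel (square_fluct (\<sigma> n))) u) sequentially"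
      using filterlim_at_top_dense[THEN iffD1, OF lims, rule_format, of "\<bar>u\<bar>"]
    proof eventually_elim
      case (elim n)
      show ?case unfolding \<theta>_def
        by (rule char_square_fluct[symmetric, OF _ lam elim]) (use \<sigma>1[of n] in linarith)
    qed
    have "(\<lambda>n. (1 - \<i> * of_real (\<theta> n)) powr (- of_real (k + 1 / 2)) *
        exp (- (of_real (u\<^sup>2 / 2) / (1 - \<i> * of_real (\<theta> n))))) \<longlonglongrightarrow>
       (1 - \<i> * of_real 0) powr (- of_real (k + 1 / 2)) * exp (- (of_real (u\<^sup>2 / 2) / (1 - \<i> * of_real 0)))"
      by (intro tendsto_intros \<theta>0) auto
    also have "(1 - \<i> * of_real 0) powr (- of_real (k + 1 / 2)) * exp (- (of_real (u\<^sup>2 / 2) / (1 - \<i> * of_real 0))) =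
       char std_normal_distribution u"
      by (simp add: char_std_normal_distribution exp_of_real[symmetric])
    finally show "(\<lambda>n. char (distr M borel (square_fluct (\<sigma> n))) u) \<longlonglongrightarrow> char std_normal_distribution u"
      by (rule Lim_transform_eventually[OF _ ev])
  qed
  moreover have "isCont (cdf std_normal_distribution) x" by (rule isCont_cdf_std_normal)
  ultimately have "(\<lambda>n. cdf (distr M borel (square_fluct (\<sigma> n))) x) \<longlonglongrightarrow> cdf std_normal_distribution x"
    by (simp add: weak_conv_m_def weak_conv_def)
  thus "(\<lambda>n. cdf (distr M borel (square_fluct (\<tau> n))) x) \<longlonglongrightarrow> cdf std_normal_distribution x"
    by (rule Lim_transform_eventually) (use eq in eventually_elim, simp)
qed

text \<open>The left side says that \<open>X t \<omega>\<close> is at most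
  \<open>t * lam + x * sqrt t\<close>. The hypothesis on \<open>x\<close> makes this threshold
  nonnegative, so both sides may be squared; expanding the square produces the extra term.\<close>

lemma fluct_le_iff:
  assumes t: "t > 0" and lam: "lam > 0" and x: "lam * sqrt t + x \<ge> 0" and \<omega>: "\<omega> \<in> space M"
  shows "(X t \<omega> - t * lam) / sqrt t \<le> x \<longleftrightarrow> square_fluct t \<omega> \<le> x + x\<^sup>2 / (2 * lam * sqrt t)"
proof -
  define s where "s = sqrt t"
  have s: "s > 0" "t = s\<^sup>2" using t by (auto simp: s_def)
  have X0: "X t \<omega> \<ge> 0" using nonneg_X \<omega> t by simp
  define w where "w = X t \<omega>"
  define c where "c = s * (lam * s + x)"
  have c: "c = x * s + t * lam" by (simp add: c_def s(2) algebra_simps power2_eq_square)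
  have "(w - t * lam) / s \<le> x \<longleftrightarrow> w \<le> c"
    unfolding pos_divide_le_eq[OF s(1)] c by linarith
  also have "\<dots> \<longleftrightarrow> w\<^sup>2 \<le> c\<^sup>2"
  proof -
    have "c \<ge> 0" using s(1) x unfolding c_def s_def by simp
    thus ?thesis using X0 abs_le_square_iff[of w c] by (simp add: w_def)
  qed
  also have "c\<^sup>2 = (lam\<^sup>2 * t / 2 + (x * (lam * s) + x\<^sup>2 / 2)) * (2 * t)"
    by (simp add: c_def s(2) algebra_simps power2_eq_square)
  also have "w\<^sup>2 \<le> \<dots> \<longleftrightarrow> w\<^sup>2 / (2 * t) \<le> lam\<^sup>2 * t / 2 + (x * (lam * s) + x\<^sup>2 / 2)"
    using t by (subst pos_divide_le_eq) auto
  also have "\<dots> \<longleftrightarrow> w\<^sup>2 / (2 * t) - lam\<^sup>2 * t / 2 \<le> x * (lam * s) + x\<^sup>2 / 2"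
    by linarith
  also have "x * (lam * s) + x\<^sup>2 / 2 = (x + x\<^sup>2 / (2 * lam * s)) * (lam * s)"
    using s(1) lam by (simp add: distrib_right)
  also have "w\<^sup>2 / (2 * t) - lam\<^sup>2 * t / 2 \<le> \<dots> \<longleftrightarrow> (w\<^sup>2 / (2 * t) - lam\<^sup>2 * t / 2) / (lam * s) \<le> x + x\<^sup>2 / (2 * lam * s)"
    using s(1) lam by (subst pos_divide_le_eq) auto
  finally show ?thesis unfolding square_fluct_def s_def w_def .
qed

text \<open>The two distribution functions agree up to the shift \<open>d t\<close>, which is
  nonnegative and tends to 0. Lower bounds follow from monotonicity; for upper bounds the shifted
  argument is replaced by a fixed \<open>y > x\<close>, and continuity of the normal distribution
  function lets \<open>y\<close> be chosen close to \<open>x\<close>.\<close>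

lemma weak_conv_fluct:
  assumes lam: "lam > 0"
  shows "weak_conv_m_filter (\<lambda>t. distr M borel (\<lambda>\<omega>. (X t \<omega> - t * lam) / sqrt t)) std_normal_distribution at_top"
  unfolding weak_conv_m_filter_def
proof (intro allI impI)
  interpret N: real_distribution std_normal_distribution by (rule real_dist_normal_dist)
  fix x :: real
  let ?W = "\<lambda>t. cdf (distr M borel (square_fluct t))"
  let ?Y = "\<lambda>t. cdf (distr M borel (\<lambda>\<omega>. (X t \<omega> - t * lam) / sqrt t))"
  define d where "d t = x\<^sup>2 / (2 * lam * sqrt t)" for t
  have lims: "filterlim (\<lambda>t. lam * sqrt t) at_top at_top"
    by (intro filterlim_tendsto_pos_mult_at_top[OF tendsto_const lam] sqrt_at_top)
  have d0: "(d \<longlongrightarrow> 0) at_top"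
  proof -
    have "((\<lambda>t. x\<^sup>2 / 2 / (lam * sqrt t)) \<longlongrightarrow> 0) at_top"
      by (rule real_tendsto_divide_at_top[OF tendsto_const lims])
    thus ?thesis by (simp add: d_def [abs_def] mult.assoc)
  qed
  have Y: "eventually (\<lambda>t. ?Y t x = ?W t (x + d t) \<and> d t \<ge> 0 \<and> t > 0) at_top"
    using eventually_gt_at_top[of 0] filterlim_at_top[THEN iffD1, OF lims, rule_format, of "- x"]
  proof eventually_elim
    case (elim t)
    have [measurable]: "X t \<in> borel_measurable M" "square_fluct t \<in> borel_measurable M"
      using elim by (auto intro: measurable_X)
    have "(\<lambda>\<omega>. (X t \<omega> - t * lam) / sqrt t) -` {..x} \<inter> space M = square_fluct t -` {..x + d t} \<inter> space M"
      using fluct_le_iff[OF elim(1) lam, of x] elim(2) by (auto simp: d_def)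
    thus ?case using elim lam by (simp add: cdf_def measure_distr d_def)
  qed
  have mono: "?W t y \<le> ?W t z" if "t > 0" "y \<le> z" for t y z
  proof -
    interpret W: real_distribution "distr M borel (square_fluct t)"
      using that by (intro real_distribution_distr) measurable
    show ?thesis by (rule W.cdf_nondecreasing[OF that(2)])
  qed
  show "((\<lambda>t. ?Y t x) \<longlongrightarrow> cdf std_normal_distribution x) at_top"
  proof (rule order_tendstoI)
    fix b assume "b < cdf std_normal_distribution x"
    hence "eventually (\<lambda>t. b < ?W t x) at_top"
      by (rule order_tendstoD(1)[OF tendsto_cdf_square_fluct[OF lam]])
    thus "eventually (\<lambda>t. b < ?Y t x) at_top"
      using Y by eventually_elim (use mono in \<open>force intro: less_le_trans\<close>)
  next
    fix b assume b: "cdf std_normal_distribution x < b"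
    have "isCont (cdf std_normal_distribution) x" by (rule isCont_cdf_std_normal)
    hence "(cdf std_normal_distribution \<longlongrightarrow> cdf std_normal_distribution x) (at_right x)"
      unfolding isCont_def by (rule filterlim_at_split[THEN iffD1, THEN conjunct2])
    from order_tendstoD(2)[OF this b] obtain z where z: "z > x" "\<And>y. x < y \<Longrightarrow> y < z \<Longrightarrow> cdf std_normal_distribution y < b"
      by (auto simp: eventually_at_right_field)
    obtain y where y: "x < y" "y < z" using dense[OF z(1)] by blast
    have "eventually (\<lambda>t. ?W t y < b) at_top"
      by (rule order_tendstoD(2)[OF tendsto_cdf_square_fluct[OF lam] z(2)[OF y]])
    moreover have "eventually (\<lambda>t. d t < y - x) at_top"
      using y by (intro order_tendstoD(2)[OF d0]) simp
    ultimately show "eventually (\<lambda>t. ?Y t x < b) at_top"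
      using Y
    proof eventually_elim
      case (elim t)
      thus ?case using mono[of t "x + d t" y] by simp
    qed
  qed
qed

end

theorem theorem6p2:
  fixes M :: "'a measure" and X :: "real \<Rightarrow> 'a \<Rightarrow> real" and k lam :: real
  assumes "bessel_process M k lam X"
    and "k \<ge> 0"
    and "lam > 0"
    and "\<And>\<omega>. \<omega> \<in> space M \<Longrightarrow> continuous_on {0..} (\<lambda>t. X t \<omega>)"
    and "AE \<omega> in M. X 0 \<omega> = 0"
  shows "(AE \<omega> in M. ((\<lambda>t. X t \<omega> / t) \<longlongrightarrow> lam) at_top) \<and>
    weak_conv_m_filter (\<lambda>t. distr M borel (\<lambda>\<omega>. (X t \<omega> - t * lam) / sqrt t))
      std_normal_distribution at_top"
proof -
  interpret bessel_process_0 M k lam X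
    using assms(1,5) by (simp add: bessel_process_0_def bessel_process_0_axioms_def)
  show ?thesis
    using AE_tendsto_drift[OF assms(3,4)] weak_conv_fluct[OF assms(3)] by simp
qed

end
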